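(* Suppose that (i) $\widetilde M:=\int_0^\infty\big(\sup_{i\in\mathcal S,u\in U}|f(s,i,u)|+\delta(s)\big)ds<\infty$; (ii) $$\Theta:=\sup_{t\in\mathbb N_0,\,i\in\mathcal S}\ \sup_{u_1,u_2\in U,\,u_1\ne u_2}\Big\{\frac{|f(t,i,u_1)-f(t,i,u_2)|}{|u_1-u_2|}+\frac{|q^{u_1}_i-q^{u_2}_i|}{|u_1-u_2|}\Big\}<\infty;$$ and (iii) $U$ satisfies the uniform cone condition. Then there exists a relaxed equilibrium for $\widetilde J$, i.e. there is $\pi\in\Pi$ such that $$\limsup_{\varepsilon\downarrow0}\frac{\widetilde J^{\pi'\otimes_\varepsilon\pi}(i)-\widetilde J^\pi(i)}{\varepsilon}\le0\quad\text{for all }\pi'\in\Pi\text{ and }i\in\mathcal S.$$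
   Context: Setting (continuous time). $\mathbb N_0=\mathbb N\cup\{0\}$. Fix $\ell,d\in\mathbb N$; $U\subset\mathbb R^\ell$ is compact with Lebesgue measure $\mathrm{Leb}(U)>0$; $\mathcal S=\{1,\dots,d\}$. For each $u\in U$, $q^u=(q^u_{ij})$ is a $d\times d$ rate matrix ($q^u_{ij}\ge0$ for $j\ne i$, $q^u_{ii}=-\sum_{j\ne i}q^u_{ij}$), with $i$-th row $q^u_i\in\mathbb R^d$. $\mathcal P(U)$ is the set of probability measures on $U$. For $\mu\in\mathcal P(U)$, $Q^\mu_{ij}:=\int_Uq^u_{ij}\mu(du)$, with $i$-th row $Q^\mu_i$. A relaxed feedback control is a map $\pi:\mathcal S\to\mathcal P(U)$; $\Pi$ is the set of all of them. Under $\pi$, $X^\pi$ is the continuous-time $\mathcal S$-valued Markov chain whose generator has $i$-th row $Q^{\pi(i)}_i$. $\mathbb E_i$ is expectation given $X_0=i$. The reward is $f:[0,\infty)\times\mathcal S\times U\to\mathbb R$, and $f^\mu(t,i):=\int_Uf(t,i,u)\mu(du)$. The discount function $\delta:[0,\infty)\to[0,1]$ is nonincreasing with $\delta(0)=1$. $|\cdot|$ is the Euclidean norm. For $\pi\in\Pi$, $\widetilde J^\pi(i):=\mathbb E_i\big[\int_0^\infty f^{\pi(X^\pi_s)}(s,X^\pi_s)ds\big]$. For $\varepsilon>0$, $\pi'\otimes_\varepsilon\pi$ means using $\pi'$ on $[0,\varepsilon)$ and $\pi$ on $[\varepsilon,\infty)$ (both for the dynamics and in the reward terms). Uniform cone condition: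 if $\ell>1$, there are $\vartheta>0$ and $\iota\in(0,\pi/2]$ such that for every $u\in U$ there is a cone with vertex $u$ and angle $\iota$, $\mathrm{cone}(u,\iota)$, with $\mathrm{cone}(u,\iota)\cap B_\vartheta(u)\subseteq U$; if $\ell=1$, there is $\vartheta>0$ such that for every $u\in U$ either $[u-\vartheta,u]\subseteq U$ or $[u,u+\vartheta]\subseteq U$. Here a cone with vertex $u$ and angle $\iota$ is any rotation about $u$ of $u+\Delta_\iota$, where $\Delta_\iota=\{v\in\mathbb R^\ell: v_\ell\ge0,\ v_1^2+\dots+v_{\ell-1}^2\le\tan^2(\iota)v_\ell^2\}$ (the half-space $v_\ell\ge0$ if $\iota=\pi/2$), and $B_\vartheta(u)$ is the ball of radius $\vartheta$ about $u$.
   Formalization: The reward f is additionally assumed Borel in t, continuous in u on U for every t ≥ 0, and such that f(t,i,·) → f(0,i,·) uniformly on U as t ↓ 0; without this the claim fails, e.g. d=1, q=0, U=[0,1], f(t,u)=u sin(ln t) for 0<t<1, else 0. *)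

theory Defs
  imports "HOL-Probability.Probability"
begin

text \<open>
  The state space is a finite type \<open>'d\<close> and the ambient space of \<open>U\<close> is \<open>real ^ 'l\<close>.
  The linear order on \<open>'l\<close> only serves to single out the last coordinate in the cone condition.
\<close>

type_synonym ('d, 'l) feedback = "'d \<Rightarrow> (real ^ 'l) measure"
type_synonym ('d, 'l) control = "real \<Rightarrow> ('d, 'l) feedback"

definition rate_matrix :: "real ^ 'd ^ 'd \<Rightarrow> bool" where
  "rate_matrix A \<longleftrightarrow>
     (\<forall>i j. j \<noteq> i \<longrightarrow> A $ i $ j \<ge> 0) \<and>
     (\<forall>i. A $ i $ i = - (\<Sum>j\<in>UNIV - {i}. A $ i $ j))"

definition relaxed_feedbacks :: "(real ^ 'l) set \<Rightarrow> ('d, 'l) feedback set" where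
  "relaxed_feedbacks U = {\<pi>. \<forall>i. \<pi> i \<in> space (prob_algebra (restrict_space borel U))}"

definition switch :: "real \<Rightarrow> ('d, 'l) feedback \<Rightarrow> ('d, 'l) feedback \<Rightarrow> ('d, 'l) control" where
  "switch \<epsilon> \<pi>' \<pi> = (\<lambda>t. if t < \<epsilon> then \<pi>' else \<pi>)"

definition stationary :: "('d, 'l) feedback \<Rightarrow> ('d, 'l) control" where
  "stationary \<pi> = (\<lambda>t. \<pi>)"

definition admissible_controls :: "(real ^ 'l) set \<Rightarrow> ('d, 'l) control set" where
  "admissible_controls U =
     {stationary \<pi> | \<pi>. \<pi> \<in> relaxed_feedbacks U} \<union>
     {switch \<epsilon> \<pi>' \<pi> | \<epsilon> \<pi>' \<pi>. \<epsilon> > 0 \<and> \<pi>' \<in> relaxed_feedbacks U \<and> \<pi> \<in> relaxed_feedbacks U}"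

definition control_generator ::
    "(real ^ 'l \<Rightarrow> real ^ 'd ^ 'd) \<Rightarrow> ('d, 'l) control \<Rightarrow> real \<Rightarrow> real ^ 'd ^ 'd" where
  "control_generator q \<alpha> t = (\<chi> i j. \<integral>u. q u $ i $ j \<partial>(\<alpha> t i))"

text \<open>
  Transition matrices \<open>p s t\<close> of a chain with time-dependent generator \<open>A\<close>, given by the
  integrated Kolmogorov forward equation. The integrated form also copes with the jump of the
  generator at a switching time; for constant \<open>A\<close> it yields \<open>p s t = exp ((t - s) A)\<close>.
\<close>

definition transition_matrices ::
    "(real \<Rightarrow> real ^ 'd ^ 'd) \<Rightarrow> (real \<Rightarrow> real \<Rightarrow> real ^ 'd ^ 'd) \<Rightarrow> bool" where
  "transition_matrices A p \<longleftrightarrow>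
     (\<forall>s\<ge>0. \<forall>t\<ge>s. ((\<lambda>r. p s r ** A r) has_integral (p s t - mat 1)) {s..t})"

definition ctmc ::
    "'w measure \<Rightarrow> (real \<Rightarrow> 'w \<Rightarrow> 'd) \<Rightarrow> (real \<Rightarrow> real ^ 'd ^ 'd) \<Rightarrow> 'd \<Rightarrow> bool" where
  "ctmc M X A i \<longleftrightarrow>
     prob_space M \<and>
     (\<forall>t\<ge>0. X t \<in> measurable M (count_space UNIV)) \<and>
     (\<forall>\<omega>\<in>space M. \<forall>t\<ge>0. \<forall>\<^sub>F s in at_right t. X s \<omega> = X t \<omega>) \<and>
     measure M {\<omega> \<in> space M. X 0 \<omega> = i} = 1 \<and>
     (\<exists>p. transition_matrices A p \<and>
       (\<forall>n. \<forall>\<tau>::nat \<Rightarrow> real. \<forall>x::nat \<Rightarrow> 'd. 0 \<le> \<tau> 0 \<and> (\<forall>m\<le>n. \<tau> m \<le> \<tau> (Suc m)) \<longrightarrow>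
         measure M {\<omega> \<in> space M. \<forall>m\<le>Suc n. X (\<tau> m) \<omega> = x m} =
         measure M {\<omega> \<in> space M. \<forall>m\<le>n. X (\<tau> m) \<omega> = x m}
           * p (\<tau> n) (\<tau> (Suc n)) $ x n $ x (Suc n)))"

text \<open>
  A choice of controlled chains: \<open>X \<alpha>\<close> under \<open>P \<alpha> i\<close> is the chain driven by \<open>\<alpha>\<close> and
  started in \<open>i\<close>. Only its law matters, and that is determined by \<open>q\<close>, \<open>\<alpha>\<close> and \<open>i\<close>.
\<close>

definition controlled_chains ::
    "(real ^ 'l) set \<Rightarrow> (real ^ 'l \<Rightarrow> real ^ 'd ^ 'd) \<Rightarrow>
     (('d, 'l) control \<Rightarrow> 'd \<Rightarrow> 'w measure) \<Rightarrow> (('d, 'l) control \<Rightarrow> real \<Rightarrow> 'w \<Rightarrow> 'd) \<Rightarrow> bool" where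
  "controlled_chains U q P X \<longleftrightarrow>
     (\<forall>\<alpha>\<in>admissible_controls U. \<forall>i. ctmc (P \<alpha> i) (X \<alpha>) (control_generator q \<alpha>) i)"

definition relaxed_reward ::
    "(real \<Rightarrow> 'd \<Rightarrow> real ^ 'l \<Rightarrow> real) \<Rightarrow> (real ^ 'l) measure \<Rightarrow> real \<Rightarrow> 'd \<Rightarrow> real" where
  "relaxed_reward f \<mu> t i = (\<integral>u. f t i u \<partial>\<mu>)"

definition payoff ::
    "(('d, 'l) control \<Rightarrow> 'd \<Rightarrow> 'w measure) \<Rightarrow> (('d, 'l) control \<Rightarrow> real \<Rightarrow> 'w \<Rightarrow> 'd) \<Rightarrow>
     (real \<Rightarrow> 'd \<Rightarrow> real ^ 'l \<Rightarrow> real) \<Rightarrow> ('d, 'l) control \<Rightarrow> 'd \<Rightarrow> real" where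
  "payoff P X f \<alpha> i =
     (\<integral>\<omega>. (LINT s:{0..}|lborel. relaxed_reward f (\<alpha> s (X \<alpha> s \<omega>)) s (X \<alpha> s \<omega>)) \<partial>(P \<alpha> i))"

definition relaxed_equilibrium ::
    "(real ^ 'l) set \<Rightarrow> (('d, 'l) control \<Rightarrow> 'd \<Rightarrow> real) \<Rightarrow> ('d, 'l) feedback \<Rightarrow> bool" where
  "relaxed_equilibrium U J \<pi> \<longleftrightarrow>
     \<pi> \<in> relaxed_feedbacks U \<and>
     (\<forall>\<pi>'\<in>relaxed_feedbacks U. \<forall>i.
        Limsup (at_right 0) (\<lambda>\<epsilon>. ereal ((J (switch \<epsilon> \<pi>' \<pi>) i - J (stationary \<pi>) i) / \<epsilon>)) \<le> 0)"

definition standard_cone :: "real \<Rightarrow> (real ^ 'l::{finite,linorder}) set" where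
  "standard_cone \<iota> = {v. v $ Max UNIV \<ge> 0 \<and>
     (\<iota> \<noteq> pi / 2 \<longrightarrow> (\<Sum>k\<in>UNIV - {Max UNIV}. (v $ k)\<^sup>2) \<le> (tan \<iota>)\<^sup>2 * (v $ Max UNIV)\<^sup>2)}"

definition is_cone ::
    "real ^ 'l::{finite,linorder} \<Rightarrow> real \<Rightarrow> (real ^ 'l::{finite,linorder}) set \<Rightarrow> bool" where
  "is_cone u \<iota> C \<longleftrightarrow>
     (\<exists>R. orthogonal_transformation R \<and> det (matrix R) = 1 \<and> C = (\<lambda>v. u + R v) ` standard_cone \<iota>)"

definition uniform_cone_condition :: "(real ^ 'l::{finite,linorder}) set \<Rightarrow> bool" where
  "uniform_cone_condition U \<longleftrightarrow>
     (if CARD('l) > 1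
      then \<exists>\<theta>>0. \<exists>\<iota>. 0 < \<iota> \<and> \<iota> \<le> pi / 2 \<and>
             (\<forall>u\<in>U. \<exists>C. is_cone u \<iota> C \<and> C \<inter> ball u \<theta> \<subseteq> U)
      else \<exists>\<theta>>0. \<forall>u\<in>U. cbox (u - vec \<theta>) u \<subseteq> U \<or> cbox u (u + vec \<theta>) \<subseteq> U)"

definition total_bound ::
    "(real ^ 'l) set \<Rightarrow> (real \<Rightarrow> 'd \<Rightarrow> real ^ 'l \<Rightarrow> real) \<Rightarrow> (real \<Rightarrow> real) \<Rightarrow> ennreal" where
  "total_bound U f \<delta> =
     (\<integral>\<^sup>+s\<in>{0..}. ((SUP i. SUP u\<in>U. ennreal \<bar>f s i u\<bar>) + ennreal (\<delta> s)) \<partial>lebesgue)"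

definition lipschitz_bound ::
    "(real ^ 'l) set \<Rightarrow> (real \<Rightarrow> 'd \<Rightarrow> real ^ 'l \<Rightarrow> real) \<Rightarrow> (real ^ 'l \<Rightarrow> real ^ 'd ^ 'd) \<Rightarrow> ennreal" where
  "lipschitz_bound U f q =
     (SUP t::nat. SUP i. SUP u\<^sub>1\<in>U. SUP u\<^sub>2\<in>U - {u\<^sub>1}.
        ennreal (\<bar>f (real t) i u\<^sub>1 - f (real t) i u\<^sub>2\<bar> / norm (u\<^sub>1 - u\<^sub>2)
               + norm (q u\<^sub>1 $ i - q u\<^sub>2 $ i) / norm (u\<^sub>1 - u\<^sub>2)))"

text \<open>
  Regularity of the reward. Measurability and continuity in the action make the integrals in the
  payoff meaningful and stable. Right-continuity at time 0 cannot be dropped: with one state,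
  \<open>U = [0, 1]\<close> and \<open>f t u = u * sin (ln t)\<close> for \<open>0 < t < 1\<close>, \<open>f t u = 0\<close> otherwise, no feedback
  is an equilibrium. Neither can continuity in the action at times other than the integers, at
  which alone the bound above controls \<open>f\<close>.
\<close>

definition regular_reward ::
    "(real ^ 'l) set \<Rightarrow> (real \<Rightarrow> 'd \<Rightarrow> real ^ 'l \<Rightarrow> real) \<Rightarrow> bool" where
  "regular_reward U f \<longleftrightarrow>
     (\<forall>i. \<forall>u\<in>U. (\<lambda>t. f t i u) \<in> borel_measurable (restrict_space borel {0..})) \<and>
     (\<forall>i. \<forall>t\<ge>0. continuous_on U (f t i)) \<and>
     (\<forall>i. uniform_limit U (\<lambda>t. f t i) (f 0 i) (at_right 0))"

end

theory Submission
  imports Defs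
begin

text \<open>
  Expanding the payoff of \<open>\<pi>' \<otimes>\<^sub>\<epsilon> \<pi>\<close> to first order in \<open>\<epsilon>\<close> shows that \<open>\<pi>\<close> is an equilibrium as soon as,
  for every state \<open>i\<close>, the measure \<open>\<pi>(i)\<close> is carried by the maximisers over \<open>U\<close> of the Hamiltonian
  \<open>H\<^sub>i(V, u) = f(0, i, u) + q\<^sup>u\<^sub>i \<cdot> V\<close>, where \<open>V\<close> is the payoff vector of \<open>\<pi>\<close> itself.

  Although \<open>V\<close> depends on \<open>\<pi>\<close> through the whole function \<open>f\<close>, the search for \<open>\<pi>\<close> is finite-dimensional:
  once the generator \<open>Q\<close> is fixed, \<open>V\<close> is linear in \<open>\<pi>\<close>, namely \<open>V\<^sub>i = \<Sum>\<^sub>k \<integral> G\<^sub>Q(i, k, u) \<pi>(k)(du)\<close> with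
  \<open>G\<^sub>Q(i, k, u) = \<integral>\<^sub>0\<^sup>\<infinity> (e\<^bsup>sQ\<^esup>)\<^sub>i\<^sub>k f(s, k, u) ds\<close>. So it suffices to find a pair \<open>(Q, V)\<close> in the convex hull of the
  points \<open>((q\<^bsup>u(k)\<^esup>\<^sub>k)\<^sub>k, (\<Sum>\<^sub>k G\<^sub>Q(i, k, u(k)))\<^sub>i)\<close>, where \<open>u\<close> runs over the profiles of actions that maximise
  all \<open>H\<^sub>i(V, \<cdot>)\<close>; the weights of the convex combination give a finitely supported \<open>\<pi>\<close>. Such a pair
  exists by Kakutani's argument from Brouwer's theorem. The matrices \<open>e\<^bsup>sQ\<^esup>\<close> are obtained as the laws of
  the given chains, and Gronwall's inequality yields their uniqueness and continuity in \<open>Q\<close>.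
\<close>

section \<open>A fixed point theorem for convex hulls\<close>

text \<open>A partition of unity on a finite \<open>e\<close>-net of \<open>S\<close> turns a choice
  of one value of \<open>A\<close> per net point into a continuous self-map, to which Brouwer's
  theorem applies. Only the argument of \<open>A\<close> is moved to nearby points;
  \<open>\<Psi>\<close> is evaluated at the fixed point itself.\<close>

lemma convex_hull_approximate_fixed_point:
  fixes S :: "'a::euclidean_space set" and K :: "'b::metric_space set"
  assumes "compact S" "convex S" "S \<noteq> {}"
    and cont: "continuous_on (S \<times> K) (\<lambda>(x, a). \<Psi> x a)"
    and maps: "\<And>x a. x \<in> S \<Longrightarrow> a \<in> K \<Longrightarrow> \<Psi> x a \<in> S"
    and A: "\<And>x. x \<in> S \<Longrightarrow> A x \<noteq> {}" "\<And>x. x \<in> S \<Longrightarrow> A x \<subseteq> K"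
    and "e > 0"
  shows "\<exists>x\<in>S. x \<in> convex hull (\<Psi> x ` (\<Union>y\<in>S \<inter> ball x e. A y))"
proof -
  obtain C where C: "finite C" "C \<subseteq> S" "S \<subseteq> (\<Union>c\<in>C. ball c e)"
    by (rule compactE_image[OF \<open>compact S\<close>, of S "\<lambda>c. ball c e"]) (use \<open>e > 0\<close> in auto)
  define a where "a c = (SOME y. y \<in> A c)" for c
  have a: "a c \<in> A c" "a c \<in> K" if "c \<in> C" for c
  proof -
    have "c \<in> S" using that C(2) by auto
    then show "a c \<in> A c" unfolding a_def using A(1) some_in_eq by blast
    then show "a c \<in> K" using A(2) \<open>c \<in> S\<close> by auto
  qed
  \<comment> \<open>Tent functions, positive exactly on the open ball of radius \<open>e\<close>
    around the centre. On \<open>S\<close> their sum \<open>s\<close> is positive, so the quotients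
    \<open>\<phi> c x / s x\<close> are continuous weights.\<close>
  define \<phi> where "\<phi> c x = max 0 (e - dist x c)" for c x :: 'a
  define s where "s x = (\<Sum>c\<in>C. \<phi> c x)" for x
  define g where "g x = (\<Sum>c\<in>C. (\<phi> c x / s x) *\<^sub>R \<Psi> x (a c))" for x
  have \<phi>_nonneg: "\<phi> c x \<ge> 0" for c x by (simp add: \<phi>_def)
  have s_pos: "s x > 0" if "x \<in> S" for x
  proof -
    have "x \<in> (\<Union>c\<in>C. ball c e)" using C(3) that by (rule subsetD)
    then obtain c where "c \<in> C" "dist c x < e" by auto
    then have "\<phi> c x > 0" by (simp add: \<phi>_def dist_commute)
    then show ?thesis unfolding s_def
      by (intro sum_pos2[OF C(1) \<open>c \<in> C\<close>]) (auto simp: \<phi>_nonneg)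
  qed
  have weights: "(\<Sum>c\<in>C. \<phi> c x / s x) = 1" if "x \<in> S" for x
    using s_pos[OF that] by (simp add: s_def flip: sum_divide_distrib)
  have "continuous_on S g"
    unfolding g_def
  proof (intro continuous_on_sum continuous_on_scaleR continuous_on_divide)
    fix c assume "c \<in> C"
    show "continuous_on S (\<phi> c)" "continuous_on S s"
      unfolding s_def \<phi>_def by (intro continuous_intros)+
    show "\<forall>x\<in>S. s x \<noteq> 0" using s_pos by force
    show "continuous_on S (\<lambda>x. \<Psi> x (a c))"
      using continuous_on_compose2[OF cont, of S "\<lambda>x. (x, a c)"] a(2)[OF \<open>c \<in> C\<close>]
      by (force intro!: continuous_intros)
  qed
  moreover have "g \<in> S \<rightarrow> S"
  proof
    fix x assume "x \<in> S"
    then show "g x \<in> S" unfolding g_def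
      using weights[of x] s_pos[of x] \<phi>_nonneg
      by (intro convex_sum[OF C(1) \<open>convex S\<close>]) (auto intro!: maps a)
  qed
  ultimately obtain x where x: "x \<in> S" "g x = x"
    using brouwer[of S g] assms(1-3) by blast
  \<comment> \<open>Centres at distance at least \<open>e\<close> have weight zero, so the fixed
    point is a combination of values selected within distance \<open>e\<close> of it.\<close>
  define C' where "C' = {c\<in>C. dist x c < e}"
  have zero: "\<phi> c x = 0" if "c \<in> C - C'" for c
    using that by (auto simp: C'_def \<phi>_def)
  have "finite C'" "C' \<subseteq> C" using C(1) by (auto simp: C'_def)
  have "(\<Sum>c\<in>C'. (\<phi> c x / s x) *\<^sub>R \<Psi> x (a c)) \<in> convex hull (\<Psi> x ` (\<Union>y\<in>S \<inter> ball x e. A y))"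
  proof (intro convex_sum[OF \<open>finite C'\<close> convex_convex_hull])
    have "(\<Sum>c\<in>C'. \<phi> c x / s x) = (\<Sum>c\<in>C. \<phi> c x / s x)"
      by (intro sum.mono_neutral_left) (use C(1) \<open>C' \<subseteq> C\<close> zero in auto)
    then show "(\<Sum>c\<in>C'. \<phi> c x / s x) = 1" using weights x(1) by simp
    fix c assume "c \<in> C'"
    then show "0 \<le> \<phi> c x / s x" using s_pos[OF x(1)] \<phi>_nonneg by simp
    have "c \<in> S \<inter> ball x e" "c \<in> C" using \<open>c \<in> C'\<close> C(2) by (auto simp: C'_def)
    then show "\<Psi> x (a c) \<in> convex hull (\<Psi> x ` (\<Union>y\<in>S \<inter> ball x e. A y))"
      using a(1) by (intro hull_inc imageI) blast
  qed
  also have "(\<Sum>c\<in>C'. (\<phi> c x / s x) *\<^sub>R \<Psi> x (a c)) = g x"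
    unfolding g_def by (intro sum.mono_neutral_left) (use C(1) \<open>C' \<subseteq> C\<close> zero in auto)
  finally show ?thesis using x by auto
qed

text \<open>Approximate fixed points at scale \<open>inverse (real (Suc n))\<close> cluster at some
  \<open>l\<close>. Instead of following whole convex combinations to the limit, the proof separates
  \<open>l\<close> from the hull at \<open>l\<close> by a hyperplane and follows a single generator
  per \<open>n\<close> on the wrong side of it.\<close>

lemma convex_hull_fixed_point:
  fixes S :: "'a::euclidean_space set" and K :: "'b::metric_space set"
  assumes S: "compact S" "convex S" "S \<noteq> {}" and K: "compact K"
    and cont: "continuous_on (S \<times> K) (\<lambda>(x, a). \<Psi> x a)"
    and maps: "\<And>x a. x \<in> S \<Longrightarrow> a \<in> K \<Longrightarrow> \<Psi> x a \<in> S"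
    and A: "\<And>x. x \<in> S \<Longrightarrow> A x \<noteq> {}" "\<And>x. x \<in> S \<Longrightarrow> A x \<subseteq> K"
    and graph: "closed {(x, a). x \<in> S \<and> a \<in> A x}"
  shows "\<exists>x\<in>S. x \<in> convex hull (\<Psi> x ` A x)"
proof -
  have "\<exists>x. x \<in> S \<and> x \<in> convex hull (\<Psi> x ` (\<Union>y\<in>S \<inter> ball x (inverse (real (Suc n))). A y))" for n
    using convex_hull_approximate_fixed_point[where A = A, OF S cont maps A, where e = "inverse (real (Suc n))"]
    by auto
  then obtain x where x: "\<And>n. x n \<in> S"
    and hull: "\<And>n. x n \<in> convex hull (\<Psi> (x n) ` (\<Union>y\<in>S \<inter> ball (x n) (inverse (real (Suc n))). A y))"
    by metis
  obtain l r where l: "l \<in> S" and r: "strict_mono (r :: nat \<Rightarrow> nat)" and xr: "(x \<circ> r) \<longlonglongrightarrow> l"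
    using S(1) x unfolding compact_def by metis
  \<comment> \<open>With a constant first sequence this makes \<open>A l\<close> closed; with moving
    base points it places the limit of the selected generators in \<open>A l\<close> below.\<close>
  have in_graph: "l \<in> S \<and> b \<in> A l"
    if "\<And>n. (y n, c n) \<in> {(x, a). x \<in> S \<and> a \<in> A x}" "y \<longlonglongrightarrow> l" "c \<longlonglongrightarrow> b" for y c l b
  proof -
    have "(\<lambda>n. (y n, c n)) \<longlonglongrightarrow> (l, b)" using that by (intro tendsto_Pair)
    then show ?thesis using closed_sequentially[OF graph, of "\<lambda>n. (y n, c n)"] that(1) by auto
  qed
  have Acl: "closed (A l)"
    unfolding closed_sequential_limits using in_graph[of "\<lambda>_. l"] l by auto
  then have "compact (A l)" using compact_Int_closed[OF K Acl] A(2)[OF l] by (simp add: Int_absorb1)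
  moreover have "continuous_on (A l) (\<Psi> l)"
    using continuous_on_compose2[OF cont, of "A l" "\<lambda>a. (l, a)"] l A(2)[OF l]
    by (force intro!: continuous_intros)
  ultimately have cl: "closed (convex hull (\<Psi> l ` A l))"
    by (intro compact_imp_closed compact_convex_hull compact_continuous_image)
  have "l \<in> convex hull (\<Psi> l ` A l)"
  proof (rule ccontr)
    assume "l \<notin> convex hull (\<Psi> l ` A l)"
    then obtain v b where v: "v \<bullet> l < b" "\<forall>y\<in>convex hull (\<Psi> l ` A l). v \<bullet> y > b"
      using separating_hyperplane_closed_point[OF convex_convex_hull cl] by blast
    \<comment> \<open>Since \<open>x n\<close> lies in the hull, the functional given by
      \<open>v\<close> cannot exceed \<open>v \<bullet> x n\<close> at every point that spans
      it.\<close>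
    have "\<exists>y c. y \<in> S \<inter> ball (x n) (inverse (real (Suc n))) \<and> c \<in> A y \<and> v \<bullet> \<Psi> (x n) c \<le> v \<bullet> x n" for n
    proof (rule ccontr)
      assume "\<not> ?thesis"
      then have "\<Psi> (x n) ` (\<Union>y\<in>S \<inter> ball (x n) (inverse (real (Suc n))). A y) \<subseteq> {z. v \<bullet> z > v \<bullet> x n}"
        by force
      then have "convex hull (\<Psi> (x n) ` (\<Union>y\<in>S \<inter> ball (x n) (inverse (real (Suc n))). A y)) \<subseteq> {z. v \<bullet> z > v \<bullet> x n}"
        by (intro hull_minimal convex_halfspace_gt)
      then show False using hull[of n] by auto
    qed
    then obtain y c where yc: "\<And>n. y n \<in> S \<inter> ball (x n) (inverse (real (Suc n)))
        \<and> c n \<in> A (y n) \<and> v \<bullet> \<Psi> (x n) (c n) \<le> v \<bullet> x n"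
      by metis
    then have y: "\<And>n. y n \<in> S" "\<And>n. dist (x n) (y n) < inverse (real (Suc n))"
      and c: "\<And>n. c n \<in> A (y n)" "\<And>n. v \<bullet> \<Psi> (x n) (c n) \<le> v \<bullet> x n"
      by auto
    have "\<forall>n. (c \<circ> r) n \<in> K" using c(1) y(1) A(2) by force
    then obtain a t where a: "a \<in> K" and t: "strict_mono (t :: nat \<Rightarrow> nat)" and ct: "(c \<circ> r \<circ> t) \<longlonglongrightarrow> a"
      using K unfolding compact_def by metis
    have xt: "(x \<circ> r \<circ> t) \<longlonglongrightarrow> l" by (rule LIMSEQ_subseq_LIMSEQ[OF xr t])
    \<comment> \<open>The base points \<open>y n\<close> and the points \<open>x n\<close> share the
      limit \<open>l\<close> along the subsequence, which brings the closed graph into play.\<close>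
    have "(\<lambda>n. dist (x n) (y n)) \<longlonglongrightarrow> 0"
      by (rule tendsto_sandwich[OF _ _ tendsto_const LIMSEQ_inverse_real_of_nat])
         (use y(2) less_imp_le in \<open>auto intro!: always_eventually\<close>)
    then have "((\<lambda>n. dist (x n) (y n)) \<circ> (r \<circ> t)) \<longlonglongrightarrow> 0"
      by (rule LIMSEQ_subseq_LIMSEQ[OF _ strict_mono_o[OF r t]])
    then have "(\<lambda>n. (x \<circ> r \<circ> t) n - (y \<circ> r \<circ> t) n) \<longlonglongrightarrow> 0"
      by (simp add: o_def dist_norm tendsto_norm_zero_iff)
    then have "(y \<circ> r \<circ> t) \<longlonglongrightarrow> l"
      using Lim_transform2[OF xt] by blast
    then have "a \<in> A l"
      using in_graph[of "y \<circ> r \<circ> t" "c \<circ> r \<circ> t"] y c ct by auto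
    have "(\<lambda>n. (\<lambda>(x, a). \<Psi> x a) ((x \<circ> r \<circ> t) n, (c \<circ> r \<circ> t) n)) \<longlonglongrightarrow> (\<lambda>(x, a). \<Psi> x a) (l, a)"
      using \<open>\<forall>n. (c \<circ> r) n \<in> K\<close>
      by (intro continuous_on_tendsto_compose[OF cont] tendsto_Pair xt ct)
         (auto simp: l a x)
    then have "(\<lambda>n. v \<bullet> \<Psi> ((x \<circ> r \<circ> t) n) ((c \<circ> r \<circ> t) n)) \<longlonglongrightarrow> v \<bullet> \<Psi> l a"
      by (auto intro!: tendsto_intros)
    moreover have "(\<lambda>n. v \<bullet> (x \<circ> r \<circ> t) n) \<longlonglongrightarrow> v \<bullet> l" by (intro tendsto_intros xt)
    ultimately have "v \<bullet> \<Psi> l a \<le> v \<bullet> l"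
      by (rule LIMSEQ_le) (use c(2) in auto)
    moreover have "v \<bullet> \<Psi> l a > b" using v(2) \<open>a \<in> A l\<close> by (auto intro: hull_inc)
    ultimately show False using v(1) by simp
  qed
  then show ?thesis using l by blast
qed

text \<open>Moves the weights of a convex combination from the image to the index set, where they
  will describe a random profile. One preimage is chosen per point; the choice is injective because
  \<open>\<phi>\<close> inverts it, so no weights merge.\<close>

lemma convex_hull_image_pmf:
  fixes \<phi> :: "'a \<Rightarrow> 'b::euclidean_space"
  assumes "x \<in> convex hull (\<phi> ` A)"
  obtains p where "finite (set_pmf p)" "set_pmf p \<subseteq> A"
    "x = (\<Sum>a\<in>set_pmf p. pmf p a *\<^sub>R \<phi> a)"
proof -
  obtain T w where T: "finite T" "T \<subseteq> \<phi> ` A" "\<forall>y\<in>T. 0 \<le> w y" "sum w T = 1"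
    "(\<Sum>y\<in>T. w y *\<^sub>R y) = x"
    using assms unfolding convex_hull_explicit by auto
  define g where "g = inv_into A \<phi>"
  have g: "g y \<in> A" "\<phi> (g y) = y" if "y \<in> T" for y
    using T(2) that by (auto simp: g_def inv_into_into f_inv_into_f)
  have inj: "inj_on g T" by (rule inj_on_inverseI[of _ \<phi>]) (use g in auto)
  define v where "v a = (if a \<in> g ` T then w (\<phi> a) else 0)" for a
  have v: "v a \<ge> 0" for a using T(3) g by (auto simp: v_def)
  have v_zero: "v a = 0" if "a \<notin> g ` T" for a using that by (simp add: v_def)
  have "(\<integral>\<^sup>+a. ennreal (v a) \<partial>count_space UNIV) = (\<Sum>a\<in>g ` T. ennreal (v a))"
    using T(1) by (intro nn_integral_count_space') (auto simp: v_zero)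
  also have "\<dots> = ennreal (\<Sum>y\<in>T. v (g y))"
    by (simp add: sum_ennreal v sum.reindex[OF inj])
  also have "(\<Sum>y\<in>T. v (g y)) = 1"
    using T(4) g(2) by (simp add: v_def cong: sum.cong)
  finally have pmf: "pmf (embed_pmf v) a = v a" for a
    using v by (intro pmf_embed_pmf) auto
  have sub: "set_pmf (embed_pmf v) \<subseteq> g ` T"
    by (rule subsetI, rule ccontr) (simp add: set_pmf_iff pmf v_zero)
  have "(\<Sum>a\<in>set_pmf (embed_pmf v). pmf (embed_pmf v) a *\<^sub>R \<phi> a)
      = (\<Sum>a\<in>g ` T. pmf (embed_pmf v) a *\<^sub>R \<phi> a)"
    by (intro sum.mono_neutral_left finite_imageI T(1) sub) (simp add: set_pmf_iff)
  also have "\<dots> = (\<Sum>a\<in>g ` T. v a *\<^sub>R \<phi> a)" by (simp only: pmf)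
  also have "\<dots> = x"
    using T(5) g(2) by (simp add: sum.reindex[OF inj] v_def cong: sum.cong)
  finally show ?thesis
    using that[of "embed_pmf v"] sub T(1) g(1) finite_subset[OF sub] by auto
qed

section \<open>Linear differential equations\<close>

text \<open>Squared norms keep the estimated function differentiable where \<open>z\<close>
  vanishes. The extra \<open>1\<close> in \<open>2 * K + 1\<close> comes from bounding twice the
  product of \<open>norm (z t)\<close> and \<open>\<beta>\<close> by the sum of their
  squares.\<close>

lemma norm_gronwall:
  fixes z :: "real \<Rightarrow> 'a::real_inner"
  assumes "a \<le> b" "K \<ge> 0" "\<beta> \<ge> 0"
    and der: "\<And>t. t \<in> {a..b} \<Longrightarrow> (z has_vector_derivative z' t) (at t within {a..b})"
    and bound: "\<And>t. t \<in> {a..b} \<Longrightarrow> norm (z' t) \<le> K * norm (z t) + \<beta>"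
  shows "(norm (z b))\<^sup>2 \<le> ((norm (z a))\<^sup>2 + \<beta>\<^sup>2 * (b - a)) * exp ((2 * K + 1) * (b - a))"
proof -
  define c where "c = 2 * K + 1"
  \<comment> \<open>An integrating factor for the growth, with a linear correction for the source
    term. It decreases because the exponential factor is at most \<open>1\<close> to the right of
    \<open>a\<close>.\<close>
  define \<phi> where "\<phi> t = (z t \<bullet> z t) * exp (- c * (t - a)) - \<beta>\<^sup>2 * (t - a)" for t
  have "c \<ge> 0" using \<open>K \<ge> 0\<close> by (simp add: c_def)
  have growth: "2 * (z t \<bullet> z' t) \<le> c * (z t \<bullet> z t) + \<beta>\<^sup>2" if "t \<in> {a..b}" for t
  proof -
    have "z t \<bullet> z' t \<le> norm (z t) * norm (z' t)" by (rule norm_cauchy_schwarz)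
    also have "\<dots> \<le> norm (z t) * (K * norm (z t) + \<beta>)"
      by (intro mult_left_mono bound that) simp
    finally have "2 * (z t \<bullet> z' t) \<le> 2 * K * (norm (z t))\<^sup>2 + 2 * (norm (z t) * \<beta>)"
      by (simp add: power2_eq_square algebra_simps)
    moreover have "2 * (norm (z t) * \<beta>) \<le> (norm (z t))\<^sup>2 + \<beta>\<^sup>2"
      using sum_squares_bound[of "norm (z t)" \<beta>] by (simp add: mult.assoc)
    ultimately have "2 * (z t \<bullet> z' t) \<le> c * (norm (z t))\<^sup>2 + \<beta>\<^sup>2"
      by (simp add: c_def algebra_simps)
    then show ?thesis by (simp add: dot_square_norm)
  qed
  have "\<phi> b \<le> \<phi> a"
  proof (rule DERIV_nonpos_imp_decreasing_open[OF \<open>a \<le> b\<close>])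
    fix t assume t: "a < t" "t < b"
    have "(z has_vector_derivative z' t) (at t)"
      using der[of t] t by (simp add: at_within_Icc_at)
    then have "((\<lambda>t. z t \<bullet> z t) has_real_derivative 2 * (z t \<bullet> z' t)) (at t)"
      using bounded_bilinear.has_vector_derivative[OF bounded_bilinear_inner, of z "z' t" t UNIV z "z' t"]
      by (simp add: has_real_derivative_iff_has_vector_derivative inner_commute)
    then have "(\<phi> has_real_derivative
        2 * (z t \<bullet> z' t) * exp (- c * (t - a)) + (z t \<bullet> z t) * (exp (- c * (t - a)) * (- c)) - \<beta>\<^sup>2) (at t)"
      unfolding \<phi>_def by (auto intro!: derivative_eq_intros)
    moreover have "2 * (z t \<bullet> z' t) * exp (- c * (t - a)) + (z t \<bullet> z t) * (exp (- c * (t - a)) * (- c)) - \<beta>\<^sup>2 \<le> 0"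
    proof -
      have "(2 * (z t \<bullet> z' t) - c * (z t \<bullet> z t)) * exp (- c * (t - a)) \<le> \<beta>\<^sup>2 * exp (- c * (t - a))"
        using growth[of t] t by (intro mult_right_mono) auto
      also have "\<dots> \<le> \<beta>\<^sup>2 * 1"
        using \<open>c \<ge> 0\<close> t by (intro mult_left_mono) auto
      finally show ?thesis by (simp add: algebra_simps)
    qed
    ultimately show "\<exists>y. (\<phi> has_real_derivative y) (at t) \<and> y \<le> 0" by blast
  next
    have "continuous_on {a..b} z"
      unfolding continuous_on_eq_continuous_within
      using der has_vector_derivative_continuous by blast
    then show "continuous_on {a..b} \<phi>"
      unfolding \<phi>_def by (intro continuous_intros)
  qed
  then have "(norm (z b))\<^sup>2 * exp (- c * (b - a)) \<le> (norm (z a))\<^sup>2 + \<beta>\<^sup>2 * (b - a)"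
    by (simp add: \<phi>_def dot_square_norm)
  then have "(norm (z b))\<^sup>2 * exp (- c * (b - a)) * exp (c * (b - a))
      \<le> ((norm (z a))\<^sup>2 + \<beta>\<^sup>2 * (b - a)) * exp (c * (b - a))"
    by (rule mult_right_mono) simp
  then have "(norm (z b))\<^sup>2 * (exp (- c * (b - a)) * exp (c * (b - a)))
      \<le> ((norm (z a))\<^sup>2 + \<beta>\<^sup>2 * (b - a)) * exp (c * (b - a))"
    by (simp only: mult.assoc)
  also have "exp (- c * (b - a)) * exp (c * (b - a)) = 1" by (simp flip: exp_add)
  finally show ?thesis by (simp add: c_def)
qed

section \<open>Matrices acting on row vectors, and the equations they drive\<close>

lemma vector_matrix_mult_sum_rows:
  fixes A :: "real ^ 'n ^ 'm"
  shows "x v* A = (\<Sum>i\<in>UNIV. x $ i *\<^sub>R A $ i)"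
  by (simp add: vec_eq_iff vector_matrix_mult_def sum_component mult.commute)

lemma bounded_bilinear_vector_matrix_mult:
  "bounded_bilinear (\<lambda>(x :: real ^ 'm) (A :: real ^ 'n ^ 'm). x v* A)"
proof
  fix x y :: "real ^ 'm" and A B :: "real ^ 'n ^ 'm" and r :: real
  show "(x + y) v* A = x v* A + y v* A" "x v* (A + B) = x v* A + x v* B"
    "(r *\<^sub>R x) v* A = r *\<^sub>R (x v* A)" "x v* (r *\<^sub>R A) = r *\<^sub>R (x v* A)"
    by (simp_all add: vector_matrix_mult_sum_rows sum.distrib scaleR_sum_right algebra_simps)
  show "\<exists>K. \<forall>x A. norm (x v* A :: real ^ 'n) \<le> norm (x :: real ^ 'm) * norm A * K"
  proof (intro exI allI)
    fix x :: "real ^ 'm" and A :: "real ^ 'n ^ 'm"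
    have "norm (x v* A) \<le> (\<Sum>i\<in>UNIV. norm (x $ i *\<^sub>R A $ i))"
      unfolding vector_matrix_mult_sum_rows by (rule norm_sum)
    also have "\<dots> \<le> (\<Sum>i::'m\<in>UNIV. norm x * norm A)"
      by (intro sum_mono) (auto intro!: mult_mono component_le_norm_cart Finite_Cartesian_Product.norm_nth_le)
    finally show "norm (x v* A) \<le> norm x * norm A * real CARD('m)" by (simp add: mult.commute)
  qed
qed

lemma vector_matrix_mult_bound:
  obtains C where "C > 0"
    "\<And>(x :: real ^ 'm) (A :: real ^ 'n ^ 'm). norm (x v* A) \<le> norm x * norm A * C"
  using bounded_bilinear.pos_bounded[OF bounded_bilinear_vector_matrix_mult] by blast

text \<open>A bootstrap: the integral equation makes \<open>x\<close> an indefinite integral and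
  hence continuous, so the integrand is continuous too and the fundamental theorem of calculus
  applies.\<close>

lemma integral_equation_has_derivative:
  fixes x :: "real \<Rightarrow> real ^ 'n"
  assumes int: "\<And>t. t \<in> {a..b} \<Longrightarrow> ((\<lambda>r. x r v* Q) has_integral (x t - x a)) {a..t}"
    and t: "t \<in> {a..b}"
  shows "(x has_vector_derivative x t v* Q) (at t within {a..b})"
proof -
  have eq: "x t = x a + integral {a..t} (\<lambda>r. x r v* Q)" if "t \<in> {a..b}" for t
    using int[OF that] by (simp add: integral_unique)
  have "(\<lambda>r. x r v* Q) integrable_on {a..b}" using int[of b] t by (auto simp: integrable_on_def)
  then have "continuous_on {a..b} (\<lambda>t. x a + integral {a..t} (\<lambda>r. x r v* Q))"
    by (intro continuous_on_add continuous_on_const indefinite_integral_continuous_1)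
  then have "continuous_on {a..b} x" by (rule continuous_on_eq) (rule eq[symmetric])
  then have "continuous_on {a..b} (\<lambda>r. x r v* Q)"
    by (intro bounded_bilinear.continuous_on[OF bounded_bilinear_vector_matrix_mult] continuous_intros)
  then have "((\<lambda>t. x a + integral {a..t} (\<lambda>r. x r v* Q)) has_vector_derivative x t v* Q) (at t within {a..b})"
    using integral_has_vector_derivative[of a b "\<lambda>r. x r v* Q" t] t
    by (auto intro!: derivative_eq_intros)
  then show ?thesis
    by (rule has_vector_derivative_transform[OF t, rotated]) (rule eq)
qed

lemma linear_ode_unique:
  fixes z :: "real \<Rightarrow> real ^ 'n"
  assumes "a \<le> b" "z a = 0"
    and der: "\<And>t. t \<in> {a..b} \<Longrightarrow> (z has_vector_derivative z t v* Q) (at t within {a..b})"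
  shows "z b = 0"
proof -
  obtain C where "C > 0" and C: "\<And>(x :: real ^ 'n) (A :: real ^ 'n ^ 'n). norm (x v* A) \<le> norm x * norm A * C"
    using vector_matrix_mult_bound by blast
  have "(norm (z b))\<^sup>2 \<le> ((norm (z a))\<^sup>2 + 0\<^sup>2 * (b - a)) * exp ((2 * (norm Q * C) + 1) * (b - a))"
  proof (rule norm_gronwall[OF \<open>a \<le> b\<close> _ _ der])
    show "norm (z t v* Q) \<le> norm Q * C * norm (z t) + 0" for t
      using C[of "z t" Q] by (simp add: mult_ac)
  qed (use \<open>C > 0\<close> in auto)
  then show ?thesis using \<open>z a = 0\<close> by simp
qed

text \<open>The difference of the two solutions satisfies a linear equation with matrix
  \<open>Q n\<close> and source \<open>y t v* (Q n - R)\<close>. Gronwall's inequality applies with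
  one constant for all \<open>n\<close>, as a convergent sequence is bounded, and the source
  vanishes in the limit.\<close>

lemma linear_ode_continuous_dependence:
  fixes x :: "nat \<Rightarrow> real \<Rightarrow> real ^ 'n" and y :: "real \<Rightarrow> real ^ 'n"
  assumes "a \<le> b" "\<And>n. x n a = y a" and bdd: "\<And>t. t \<in> {a..b} \<Longrightarrow> norm (y t) \<le> B"
    and x: "\<And>n t. t \<in> {a..b} \<Longrightarrow> (x n has_vector_derivative x n t v* Q n) (at t within {a..b})"
    and y: "\<And>t. t \<in> {a..b} \<Longrightarrow> (y has_vector_derivative y t v* R) (at t within {a..b})"
    and lim: "Q \<longlonglongrightarrow> R"
  shows "(\<lambda>n. x n b) \<longlonglongrightarrow> y b"
proof -
  obtain C where "C > 0" and C: "\<And>(x :: real ^ 'n) (A :: real ^ 'n ^ 'n). norm (x v* A) \<le> norm x * norm A * C"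
    using vector_matrix_mult_bound by blast
  obtain M where M: "M > 0" "\<And>n. norm (Q n) \<le> M"
    using convergent_imp_Bseq[of Q] lim unfolding convergent_def Bseq_def by blast
  have "B \<ge> 0" using bdd[of a] \<open>a \<le> b\<close> by (meson atLeastAtMost_iff norm_ge_zero order_refl order_trans)
  define \<beta> where "\<beta> n = B * norm (Q n - R) * C" for n
  have \<beta>: "\<beta> n \<ge> 0" for n using \<open>B \<ge> 0\<close> \<open>C > 0\<close> by (simp add: \<beta>_def)
  have est: "(norm (x n b - y b))\<^sup>2 \<le> ((norm (x n a - y a))\<^sup>2 + (\<beta> n)\<^sup>2 * (b - a)) * exp ((2 * (M * C) + 1) * (b - a))" for n
  proof (rule norm_gronwall[OF \<open>a \<le> b\<close>])
    fix t assume t: "t \<in> {a..b}"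
    show "((\<lambda>t. x n t - y t) has_vector_derivative (x n t v* Q n - y t v* R)) (at t within {a..b})"
      by (intro derivative_intros x y t)
    have "x n t v* Q n - y t v* R = (x n t - y t) v* Q n + y t v* (Q n - R)"
      by (simp add: algebra_simps)
    also have "norm \<dots> \<le> norm (x n t - y t) * norm (Q n) * C + norm (y t) * norm (Q n - R) * C"
      by (intro norm_triangle_mono C)
    also have "\<dots> \<le> norm (x n t - y t) * M * C + B * norm (Q n - R) * C"
      using \<open>C > 0\<close> M(2)[of n] bdd[OF t] by (intro add_mono mult_right_mono mult_left_mono) auto
    finally show "norm (x n t v* Q n - y t v* R) \<le> M * C * norm (x n t - y t) + \<beta> n"
      by (simp add: \<beta>_def mult_ac)
  qed (use \<beta> \<open>M > 0\<close> \<open>C > 0\<close> in auto)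
  have "\<beta> \<longlonglongrightarrow> B * norm (R - R) * C" unfolding \<beta>_def by (intro tendsto_intros lim)
  then have lim0: "(\<lambda>n. ((\<beta> n)\<^sup>2 * (b - a)) * exp ((2 * (M * C) + 1) * (b - a))) \<longlonglongrightarrow> 0"
    using tendsto_mult_right[OF tendsto_mult_right[OF tendsto_power, of \<beta> 0 sequentially 2 "b - a"],
        of "exp ((2 * (M * C) + 1) * (b - a))"] by simp
  have "norm ((norm (x n b - y b))\<^sup>2) \<le> ((\<beta> n)\<^sup>2 * (b - a)) * exp ((2 * (M * C) + 1) * (b - a))" for n
    using est[of n] by (simp add: assms(2))
  then have "(\<lambda>n. (norm (x n b - y b))\<^sup>2) \<longlonglongrightarrow> 0"
    by (intro Lim_null_comparison[OF _ lim0] always_eventually allI)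
  from tendsto_real_sqrt[OF this] have "(\<lambda>n. norm (x n b - y b)) \<longlonglongrightarrow> 0"
    by simp
  then show ?thesis by (simp add: LIM_zero_iff tendsto_norm_zero_iff)
qed

lemma integral_equation_has_derivative_atLeast:
  fixes x :: "real \<Rightarrow> real ^ 'n"
  assumes int: "\<And>t. t \<ge> a \<Longrightarrow> ((\<lambda>r. x r v* Q) has_integral (x t - x a)) {a..t}" and "t \<ge> a"
  shows "(x has_vector_derivative x t v* Q) (at t within {a..})"
proof -
  \<comment> \<open>The interval reaches beyond \<open>t\<close>, so that near \<open>t\<close> it
    coincides with the half-line.\<close>
  have "(x has_vector_derivative x t v* Q) (at t within {a..t + 1})"
    by (rule integral_equation_has_derivative) (use assms in auto)
  moreover have "at t within {a..t + 1} = at t within {a..}"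
    by (rule at_within_nhd[of t "{..<t + 1}"]) auto
  ultimately show ?thesis by simp
qed

text \<open>The \<open>x j\<close> form a fundamental system. Restarted at time \<open>a\<close> and
  combined with the coordinates of \<open>y a\<close>, they solve the equation of \<open>y\<close>
  with the same initial value. This replaces the semigroup property of the matrix
  exponential.\<close>

lemma linear_ode_decomposition:
  fixes y :: "real \<Rightarrow> real ^ 'n" and x :: "'n \<Rightarrow> real \<Rightarrow> real ^ 'n"
  assumes x0: "\<And>j. x j 0 = axis j 1"
    and x: "\<And>j t. t \<ge> 0 \<Longrightarrow> (x j has_vector_derivative x j t v* Q) (at t within {0..})"
    and y: "\<And>t. t \<ge> a \<Longrightarrow> (y has_vector_derivative y t v* Q) (at t within {a..})"
    and "t \<ge> a"
  shows "y t = (\<Sum>j\<in>UNIV. y a $ j *\<^sub>R x j (t - a))"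
proof -
  define w where "w t = y t - (\<Sum>j\<in>UNIV. y a $ j *\<^sub>R x j (t - a))" for t
  have "w t = 0"
  proof (rule linear_ode_unique[OF \<open>t \<ge> a\<close>])
    show "w a = 0" by (simp add: w_def x0 basis_expansion flip: scalar_mult_eq_scaleR)
    fix s assume s: "s \<in> {a..t}"
    have "((x j \<circ> (\<lambda>t. t - a)) has_vector_derivative 1 *\<^sub>R (x j (s - a) v* Q)) (at s within {a..t})" for j
    proof (rule vector_diff_chain_within)
      show "((\<lambda>t. t - a) has_vector_derivative 1) (at s within {a..t})"
        by (auto intro!: derivative_eq_intros)
      show "(x j has_vector_derivative x j (s - a) v* Q) (at (s - a) within (\<lambda>t. t - a) ` {a..t})"
        by (rule has_vector_derivative_within_subset[OF x]) (use s in auto)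
    qed
    then have "((\<lambda>t. x j (t - a)) has_vector_derivative x j (s - a) v* Q) (at s within {a..t})" for j
      by (simp add: o_def)
    moreover have "(y has_vector_derivative y s v* Q) (at s within {a..t})"
      by (rule has_vector_derivative_within_subset[OF y]) (use s in auto)
    ultimately have "(w has_vector_derivative
        y s v* Q - (\<Sum>j\<in>UNIV. y a $ j *\<^sub>R (x j (s - a) v* Q))) (at s within {a..t})"
      unfolding w_def by (intro has_vector_derivative_diff has_vector_derivative_sum
        bounded_linear.has_vector_derivative[OF bounded_linear_scaleR_right])
    also have "y s v* Q - (\<Sum>j\<in>UNIV. y a $ j *\<^sub>R (x j (s - a) v* Q)) = w s v* Q"
      unfolding w_def
      by (simp add: bounded_bilinear.diff_left[OF bounded_bilinear_vector_matrix_mult]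
          bounded_bilinear.sum_left[OF bounded_bilinear_vector_matrix_mult]
          bounded_bilinear.scaleR_left[OF bounded_bilinear_vector_matrix_mult])
    finally show "(w has_vector_derivative w s v* Q) (at s within {a..t})" .
  qed
  then show ?thesis by (simp add: w_def)
qed

text \<open>The first estimate feeds the second. The integrand has norm at most \<open>C\<close>, so
  \<open>y\<close> moves by at most \<open>C * t\<close>; hence the integrand stays within
  \<open>C\<^sup>2 * a\<close> of its initial value, over an interval of length
  \<open>a\<close>.\<close>

lemma linear_ode_first_order:
  fixes y :: "real \<Rightarrow> real ^ 'n" and Q :: "real ^ 'n ^ 'n"
  assumes int: "\<And>t. t \<in> {0..a} \<Longrightarrow> ((\<lambda>r. y r v* Q) has_integral (y t - e)) {0..t}"
    and bdd: "\<And>t. t \<in> {0..a} \<Longrightarrow> norm (y t) \<le> 1"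
    and C: "C \<ge> 0" "\<And>x :: real ^ 'n. norm (x v* Q) \<le> C * norm x"
  shows "t \<in> {0..a} \<Longrightarrow> norm (y t - e) \<le> C * t"
    and "a \<ge> 0 \<Longrightarrow> norm (y a - e - a *\<^sub>R (e v* Q)) \<le> C\<^sup>2 * a\<^sup>2"
proof -
  show first: "norm (y t - e) \<le> C * t" if "t \<in> {0..a}" for t
  proof -
    have "norm (y r v* Q) \<le> C" if "r \<in> {0..t}" for r
      using C(2)[of "y r"] bdd[of r] that \<open>t \<in> {0..a}\<close> mult_left_mono[of "norm (y r)" 1 C] C(1) by auto
    then show ?thesis
      using has_integral_bound_real[OF C(1) finite.emptyI int[OF that]] that by auto
  qed
  assume "a \<ge> 0"
  have "((\<lambda>r. y r v* Q - e v* Q) has_integral (y a - e - (a - 0) *\<^sub>R (e v* Q))) {0..a}"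
    using \<open>a \<ge> 0\<close> has_integral_const_real[of "e v* Q" 0 a] by (intro has_integral_diff int) auto
  moreover have "norm (y r v* Q - e v* Q) \<le> C\<^sup>2 * a" if "r \<in> {0..a}" for r
  proof -
    have "norm (y r v* Q - e v* Q) = norm ((y r - e) v* Q)" by (simp add: algebra_simps)
    also have "\<dots> \<le> C * norm (y r - e)" by (rule C)
    also have "\<dots> \<le> C * (C * a)"
      using first[OF that] that mult_left_mono[of r a C] C(1) by (intro mult_left_mono) auto
    finally show ?thesis by (simp add: power2_eq_square)
  qed
  ultimately have "norm (y a - e - (a - 0) *\<^sub>R (e v* Q)) \<le> C\<^sup>2 * a * measure lborel {0..a}"
    using \<open>a \<ge> 0\<close> C(1) by (intro has_integral_bound_real[OF _ finite.emptyI]) auto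
  then show "norm (y a - e - a *\<^sub>R (e v* Q)) \<le> C\<^sup>2 * a\<^sup>2"
    using \<open>a \<ge> 0\<close> by (simp add: power2_eq_square)
qed

section \<open>Laws of controlled chains\<close>

text \<open>A row vector, so that the forward equation can be written with
  \<open>v*\<close>.\<close>

definition law :: "'w measure \<Rightarrow> (real \<Rightarrow> 'w \<Rightarrow> 'd) \<Rightarrow> real \<Rightarrow> real ^ 'd" where
  "law M X t = (\<chi> k. measure M {\<omega> \<in> space M. X t \<omega> = k})"

lemma law_nonneg: "0 \<le> law M X t $ k"
  by (simp add: law_def)

lemma law_le_1: "prob_space M \<Longrightarrow> law M X t $ k \<le> 1"
  by (simp add: law_def prob_space.prob_le_1)

lemma sum_law:
  fixes X :: "real \<Rightarrow> 'w \<Rightarrow> 'd::finite"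
  assumes "prob_space M" and [measurable]: "X t \<in> measurable M (count_space UNIV)"
  shows "(\<Sum>k\<in>UNIV. law M X t $ k) = 1"
proof -
  interpret prob_space M by fact
  have "(\<Sum>k\<in>UNIV. law M X t $ k) = measure M (\<Union>k\<in>UNIV. {\<omega> \<in> space M. X t \<omega> = k})"
    unfolding law_def vec_lambda_beta
    by (intro finite_measure_finite_Union[symmetric]) (auto simp: disjoint_family_on_def)
  also have "(\<Union>k\<in>UNIV. {\<omega> \<in> space M. X t \<omega> = k}) = space M" by auto
  finally show ?thesis by (simp add: prob_space)
qed

lemma ctmcD:
  assumes "ctmc M X A i"
  shows "prob_space M" "\<And>t. t \<ge> 0 \<Longrightarrow> X t \<in> measurable M (count_space UNIV)"
    "\<And>\<omega> t. \<omega> \<in> space M \<Longrightarrow> t \<ge> 0 \<Longrightarrow> \<forall>\<^sub>F s in at_right t. X s \<omega> = X t \<omega>"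
  using assms unfolding ctmc_def by auto

lemma norm_law_le_1:
  fixes X :: "real \<Rightarrow> 'w \<Rightarrow> 'd::finite"
  assumes "ctmc M X A i" "t \<ge> 0"
  shows "norm (law M X t) \<le> 1"
  using norm_le_l1_cart[of "law M X t"] sum_law[where X = X and t = t, OF ctmcD(1)[OF assms(1)] ctmcD(2)[OF assms]]
  by (simp add: law_nonneg)

text \<open>The product formula in \<open>ctmc\<close> is used for the two times \<open>0\<close>
  and \<open>t\<close> only. The initial event has probability one, so it disappears both as a
  factor and from the intersection, leaving a marginal on one side and an entry of
  \<open>p 0 t\<close> on the other.\<close>

lemma ctmc_law_eq:
  assumes "ctmc M X A i"
  obtains p where "transition_matrices A p" "\<And>t. t \<ge> 0 \<Longrightarrow> law M X t = p 0 t $ i"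
proof -
  interpret prob_space M using assms by (rule ctmcD)
  obtain p where p: "transition_matrices A p"
    and markov: "\<And>n (\<tau>::nat \<Rightarrow> real) x. 0 \<le> \<tau> 0 \<and> (\<forall>m\<le>n. \<tau> m \<le> \<tau> (Suc m)) \<Longrightarrow>
         measure M {\<omega> \<in> space M. \<forall>m\<le>Suc n. X (\<tau> m) \<omega> = x m} =
         measure M {\<omega> \<in> space M. \<forall>m\<le>n. X (\<tau> m) \<omega> = x m}
           * p (\<tau> n) (\<tau> (Suc n)) $ x n $ x (Suc n)"
    and start: "measure M {\<omega> \<in> space M. X 0 \<omega> = i} = 1"
  proof -
    from assms have "\<exists>p. transition_matrices A p \<and>
       (\<forall>n. \<forall>\<tau>::nat \<Rightarrow> real. \<forall>x::nat \<Rightarrow> 'b. 0 \<le> \<tau> 0 \<and> (\<forall>m\<le>n. \<tau> m \<le> \<tau> (Suc m)) \<longrightarrow>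
         measure M {\<omega> \<in> space M. \<forall>m\<le>Suc n. X (\<tau> m) \<omega> = x m} =
         measure M {\<omega> \<in> space M. \<forall>m\<le>n. X (\<tau> m) \<omega> = x m}
           * p (\<tau> n) (\<tau> (Suc n)) $ x n $ x (Suc n))"
      unfolding ctmc_def by (elim conjE)
    moreover have "measure M {\<omega> \<in> space M. X 0 \<omega> = i} = 1"
      using assms by (simp add: ctmc_def)
    ultimately show thesis using that by blast
  qed
  have meas: "{\<omega> \<in> space M. X t \<omega> = k} \<in> sets M" if "t \<ge> 0" for t k
    using ctmcD(2)[OF assms that] by measurable
  have "law M X t $ k = p 0 t $ i $ k" if "t \<ge> 0" for t k
  proof -
    let ?\<tau> = "\<lambda>m::nat. if m = 0 then 0 else t" and ?x = "\<lambda>m::nat. if m = 0 then i else k"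
    have "{\<omega> \<in> space M. \<forall>m\<le>Suc 0. X (?\<tau> m) \<omega> = ?x m}
        = {\<omega> \<in> space M. X 0 \<omega> = i} \<inter> {\<omega> \<in> space M. X t \<omega> = k}"
      by (auto simp: le_Suc_eq)
    moreover have "AE \<omega> in M. \<omega> \<in> {\<omega> \<in> space M. X 0 \<omega> = i}"
      using start by (rule AE_prob_1)
    then have "measure M ({\<omega> \<in> space M. X 0 \<omega> = i} \<inter> {\<omega> \<in> space M. X t \<omega> = k})
        = measure M {\<omega> \<in> space M. X t \<omega> = k}"
      by (intro finite_measure_eq_AE) (use meas that in auto)
    moreover have "measure M {\<omega> \<in> space M. \<forall>m\<le>Suc 0. X (?\<tau> m) \<omega> = ?x m}
        = measure M {\<omega> \<in> space M. \<forall>m\<le>0. X (?\<tau> m) \<omega> = ?x m}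
           * p (?\<tau> 0) (?\<tau> (Suc 0)) $ ?x 0 $ ?x (Suc 0)"
      by (rule markov) (use that in auto)
    ultimately show ?thesis using start by (simp add: law_def)
  qed
  then show ?thesis using that[OF p] by (simp add: vec_eq_iff)
qed

lemma ctmc_law_0:
  assumes "ctmc M X A i"
  shows "law M X 0 = axis i 1"
proof -
  obtain p where p: "transition_matrices A p" "\<And>t. t \<ge> 0 \<Longrightarrow> law M X t = p 0 t $ i"
    using ctmc_law_eq[OF assms] by blast
  \<comment> \<open>Over a degenerate interval the integral is zero, which forces
    \<open>p 0 0\<close> to be the identity.\<close>
  have "((\<lambda>r. p 0 r ** A r) has_integral (p 0 0 - mat 1)) {0..0}"
    using p(1) unfolding transition_matrices_def by blast
  then have "p 0 0 - mat 1 = 0"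
    by (rule has_integral_unique) (simp add: has_integral_refl)
  then have "p 0 0 = mat 1" by simp
  then show ?thesis using p(2)[of 0] by (auto simp: vec_eq_iff mat_def axis_def)
qed

text \<open>Row \<open>i\<close> of the matrix forward equation is already a closed equation for the
  law.\<close>

lemma ctmc_law_has_integral:
  assumes "ctmc M X A i" "t \<ge> 0"
  shows "((\<lambda>r. law M X r v* A r) has_integral (law M X t - axis i 1)) {0..t}"
proof -
  obtain p where p: "transition_matrices A p" "\<And>t. t \<ge> 0 \<Longrightarrow> law M X t = p 0 t $ i"
    using ctmc_law_eq[OF assms(1)] by blast
  have "((\<lambda>r. p 0 r ** A r) has_integral (p 0 t - mat 1)) {0..t}"
    using p(1) \<open>t \<ge> 0\<close> unfolding transition_matrices_def by auto
  from has_integral_linear[OF this bounded_linear_vec_nth[of i]]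
  have "((\<lambda>r. (p 0 r ** A r) $ i) has_integral (p 0 t $ i - mat 1 $ i)) {0..t}"
    by (simp add: o_def)
  moreover have "mat 1 $ i = (axis i 1 :: real ^ 'b)"
    by (auto simp: vec_eq_iff mat_def axis_def)
  moreover have "(p 0 r ** A r) $ i = law M X r v* A r" if "r \<in> {0..t}" for r
    using p(2)[of r] that by (simp add: vec_eq_iff matrix_matrix_mult_def vector_matrix_mult_def mult.commute)
  ultimately show ?thesis
    using p(2)[OF \<open>t \<ge> 0\<close>] has_integral_eq[of "{0..t}" "\<lambda>r. (p 0 r ** A r) $ i" "\<lambda>r. law M X r v* A r"]
    by simp
qed

section \<open>Joint measurability of paths, and expected rewards\<close>

text \<open>
  Sampling a path from the right at \<open>(\<lfloor>s n\<rfloor> + 1) / n\<close> is eventually exact at \<open>s\<close>, and each sample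
  depends on \<open>s\<close> only through a countable index.
\<close>

lemma right_continuous_jointly_measurable:
  fixes X :: "real \<Rightarrow> 'w \<Rightarrow> 'd"
  assumes X: "\<And>t. t \<ge> 0 \<Longrightarrow> X t \<in> measurable M (count_space UNIV)"
    and rc: "\<And>\<omega> t. \<omega> \<in> space M \<Longrightarrow> t \<ge> 0 \<Longrightarrow> \<forall>\<^sub>F s in at_right t. X s \<omega> = X t \<omega>"
  shows "(\<lambda>(\<omega>, s). of_bool (s \<ge> 0 \<and> X s \<omega> = k) :: real) \<in> borel_measurable (M \<Otimes>\<^sub>M lborel)"
proof -
  define \<tau> where "\<tau> n s = real (Suc (nat \<lfloor>s * real (Suc n)\<rfloor>)) / real (Suc n)" for n s
  define h where "h n = (\<lambda>(\<omega>, s). of_bool (s \<ge> 0 \<and> X (\<tau> n s) \<omega> = k) :: real)" for n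
  show ?thesis
  proof (rule borel_measurable_LIMSEQ_real[where u = h])
    fix n
    have "(\<lambda>z. (\<lambda>m z. of_bool ((snd z :: real) \<ge> 0 \<and> X (real (Suc m) / real (Suc n)) (fst z) = k) :: real)
          (nat \<lfloor>snd z * real (Suc n)\<rfloor>) z) \<in> borel_measurable (M \<Otimes>\<^sub>M lborel)"
    proof (rule measurable_compose_countable[where g = "\<lambda>z. nat \<lfloor>snd z * real (Suc n)\<rfloor>"
          and f = "\<lambda>m z. of_bool (snd z \<ge> 0 \<and> X (real (Suc m) / real (Suc n)) (fst z) = k)"])
      fix m
      have [measurable]: "X (real (Suc m) / real (Suc n)) \<in> measurable M (count_space UNIV)"
        by (rule X) simp
      show "(\<lambda>z. of_bool ((snd z :: real) \<ge> 0 \<and> X (real (Suc m) / real (Suc n)) (fst z) = k) :: real)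
          \<in> borel_measurable (M \<Otimes>\<^sub>M lborel)"
        by measurable
    qed measurable
    then show "h n \<in> borel_measurable (M \<Otimes>\<^sub>M lborel)"
      by (simp add: h_def \<tau>_def split_beta')
  next
    fix z :: "'w \<times> real" assume z: "z \<in> space (M \<Otimes>\<^sub>M lborel)"
    obtain \<omega> s where zs: "z = (\<omega>, s)" by (cases z)
    have "\<omega> \<in> space M" using z zs by (simp add: space_pair_measure)
    have "\<forall>\<^sub>F n in sequentially. h n z = (case z of (\<omega>, s) \<Rightarrow> of_bool (s \<ge> 0 \<and> X s \<omega> = k))"
    proof (cases "s \<ge> 0")
      case True
      \<comment> \<open>The \<open>Suc\<close> in the numerator of \<open>\<tau>\<close> makes the
        lower bound strict; this matters because \<open>rc\<close> speaks only of times after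
        \<open>s\<close>.\<close>
      have \<tau>_bounds: "s < \<tau> n s" "\<tau> n s \<le> s + inverse (real (Suc n))" for n
      proof -
        have eq: "real (Suc (nat \<lfloor>s * real (Suc n)\<rfloor>)) = of_int \<lfloor>s * real (Suc n)\<rfloor> + 1"
          using True by (simp del: of_nat_Suc add: of_nat_Suc[of "nat _"])
        have "s * real (Suc n) < real (Suc (nat \<lfloor>s * real (Suc n)\<rfloor>))"
          "real (Suc (nat \<lfloor>s * real (Suc n)\<rfloor>)) \<le> s * real (Suc n) + 1"
          unfolding eq using floor_correct[of "s * real (Suc n)"] by linarith+
        then show "s < \<tau> n s" "\<tau> n s \<le> s + inverse (real (Suc n))"
          unfolding \<tau>_def by (simp_all add: field_simps del: of_nat_Suc)
      qed
      have "(\<lambda>n. s + inverse (real (Suc n))) \<longlonglongrightarrow> s + 0"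
        by (intro tendsto_add tendsto_const LIMSEQ_inverse_real_of_nat)
      then have "(\<lambda>n. \<tau> n s) \<longlonglongrightarrow> s"
        using \<tau>_bounds by (intro tendsto_sandwich[of "\<lambda>_. s" "\<lambda>n. \<tau> n s" sequentially "\<lambda>n. s + inverse (real (Suc n))"])
          (auto intro!: always_eventually less_imp_le)
      moreover have "\<tau> n s \<noteq> s" for n using \<tau>_bounds(1)[of n] by simp
      ultimately have "filterlim (\<lambda>n. \<tau> n s) (at_right s) sequentially"
        using \<tau>_bounds(1) by (simp add: filterlim_at)
      from eventually_compose_filterlim[OF rc[OF \<open>\<omega> \<in> space M\<close> True] this]
      show ?thesis by eventually_elim (simp add: h_def zs)
    qed (simp add: h_def zs)
    then show "(\<lambda>n. h n z) \<longlonglongrightarrow> (case z of (\<omega>, s) \<Rightarrow> of_bool (s \<ge> 0 \<and> X s \<omega> = k))"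
      by (rule tendsto_eventually)
  qed
qed

text \<open>Once the reward along a path is split by the current state, the path enters only through
  an indicator whose expectation is the law. Fubini's theorem then exchanges expectation and time
  integral.\<close>

lemma expected_reward_eq:
  fixes X :: "real \<Rightarrow> 'w \<Rightarrow> 'd::finite"
  assumes "ctmc M X A i" and g: "\<And>k. set_integrable lborel {0..} (g k)"
  shows "(\<integral>\<omega>. (LINT s:{0..}|lborel. g (X s \<omega>) s) \<partial>M)
    = (LINT s:{0..}|lborel. (\<Sum>k\<in>UNIV. law M X s $ k * g k s))"
proof -
  interpret prob_space M using assms(1) by (rule ctmcD)
  interpret pair_sigma_finite M lborel ..
  define h where "h k \<omega> s = (of_bool (s \<ge> 0 \<and> X s \<omega> = k) :: real)" for k \<omega> s
  define G where "G k s = indicator {0..} s * g k s" for k s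
  have G: "integrable lborel (G k)" for k
    using g[of k] by (simp add: set_integrable_def G_def[abs_def])
  have [measurable]: "(\<lambda>z. h k (fst z) (snd z)) \<in> borel_measurable (M \<Otimes>\<^sub>M lborel)" for k
    using right_continuous_jointly_measurable[OF ctmcD(2,3)[OF assms(1)], of k]
    unfolding h_def split_beta' by simp
  have h_bounds: "0 \<le> h k \<omega> s" "h k \<omega> s \<le> 1" for k \<omega> s by (simp_all add: h_def)
  have [measurable]: "G k \<in> borel_measurable lborel" for k using G by blast
  \<comment> \<open>A function of time alone is integrable on the product because \<open>M\<close>
    is a probability measure; it dominates its product with the indicator \<open>h\<close>.\<close>
  have int_snd: "integrable (M \<Otimes>\<^sub>M lborel) (\<lambda>z. G k (snd z))" for k
    by (rule Fubini_integrable) (use G in \<open>auto simp: integrable_norm\<close>)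
  have hG: "integrable (M \<Otimes>\<^sub>M lborel) (\<lambda>(\<omega>, s). h k \<omega> s * G k s)" for k
    by (rule Bochner_Integration.integrable_bound[OF int_snd[of k]])
      (auto simp: split_beta' abs_mult h_bounds intro!: mult_left_le_one_le)
  have sumG: "g (X s \<omega>) s = (\<Sum>k\<in>UNIV. h k \<omega> s * G k s)" if "s \<ge> 0" for s \<omega>
  proof -
    have "(\<Sum>k\<in>UNIV. h k \<omega> s * G k s) = (\<Sum>k\<in>UNIV. if X s \<omega> = k then G k s else 0)"
      using that by (intro sum.cong) (auto simp: h_def)
    then show ?thesis using that by (simp add: G_def)
  qed
  have zero: "G k s = 0" if "\<not> s \<ge> 0" for k s using that by (simp add: G_def)
  have meas: "{\<omega> \<in> space M. X t \<omega> = k} \<in> sets M" if "t \<ge> 0" for t k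
    using ctmcD(2)[OF assms(1) that] by measurable
  have "(\<integral>\<omega>. h k \<omega> s * G k s \<partial>M) = indicator {0..} s * (law M X s $ k * g k s)" for k s
  proof (cases "s \<ge> 0")
    case True
    have "(\<integral>\<omega>. h k \<omega> s \<partial>M) = (\<integral>\<omega>. indicator {\<omega> \<in> space M. X s \<omega> = k} \<omega> \<partial>M)"
      using True by (intro Bochner_Integration.integral_cong) (auto simp: h_def indicator_def)
    also have "\<dots> = law M X s $ k"
      using meas[OF True] by (simp add: law_def Int_absorb1 subset_eq)
    finally show ?thesis using True by (simp add: G_def)
  qed (simp add: G_def)
  note integral_h = this
  have "(\<integral>\<omega>. (LINT s:{0..}|lborel. g (X s \<omega>) s) \<partial>M) = (\<integral>\<omega>. (\<integral>s. (\<Sum>k\<in>UNIV. h k \<omega> s * G k s) \<partial>lborel) \<partial>M)"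
    unfolding set_lebesgue_integral_def
    by (intro Bochner_Integration.integral_cong refl) (auto simp: sumG zero indicator_def)
  also have "\<dots> = (\<integral>s. (\<integral>\<omega>. (\<Sum>k\<in>UNIV. h k \<omega> s * G k s) \<partial>M) \<partial>lborel)"
    by (rule Fubini_integral[symmetric]) (use hG in \<open>auto simp: split_beta' intro!: Bochner_Integration.integrable_sum\<close>)
  also have "\<dots> = (\<integral>s. (\<Sum>k\<in>UNIV. indicator {0..} s * (law M X s $ k * g k s)) \<partial>lborel)"
  proof (intro Bochner_Integration.integral_cong refl)
    fix s
    have "integrable M (\<lambda>\<omega>. h k \<omega> s * G k s)" for k
    proof (cases "s \<ge> 0")
      case True
      have "integrable M (\<lambda>\<omega>. indicator {\<omega> \<in> space M. X s \<omega> = k} \<omega> * G k s)"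
        using meas[OF True] by (intro integrable_mult_left integrable_indicator) (auto simp: emeasure_eq_measure)
      also have "?this \<longleftrightarrow> ?thesis"
        using True by (intro Bochner_Integration.integrable_cong refl) (auto simp: h_def indicator_def)
      finally show ?thesis .
    qed (simp add: zero)
    then show "(\<integral>\<omega>. (\<Sum>k\<in>UNIV. h k \<omega> s * G k s) \<partial>M)
        = (\<Sum>k\<in>UNIV. indicator {0..} s * (law M X s $ k * g k s))"
      by (subst Bochner_Integration.integral_sum) (simp_all only: integral_h)
  qed
  finally show ?thesis by (simp add: set_lebesgue_integral_def sum_distrib_left)
qed

text \<open>The law is an integral over paths of a jointly measurable indicator, hence measurable in
  the remaining variable.\<close>

lemma law_measurable:
  fixes X :: "real \<Rightarrow> 'w \<Rightarrow> 'd::finite"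
  assumes "ctmc M X A i"
  shows "(\<lambda>s. indicator {0..} s * law M X s $ k) \<in> borel_measurable lborel"
proof -
  interpret prob_space M using assms by (rule ctmcD)
  interpret pair_sigma_finite M lborel ..
  define h where "h \<omega> s = (of_bool (s \<ge> 0 \<and> X s \<omega> = k) :: real)" for \<omega> s
  have "case_prod h \<in> borel_measurable (M \<Otimes>\<^sub>M lborel)"
    using right_continuous_jointly_measurable[OF ctmcD(2,3)[OF assms], of k]
    unfolding h_def by simp
  from measurable_pair_swap[OF this]
  have swap: "case_prod (\<lambda>s \<omega>. h \<omega> s) \<in> borel_measurable (lborel \<Otimes>\<^sub>M M)"
    by (simp add: split_beta')
  have "sigma_finite_measure M" ..
  from sigma_finite_measure.borel_measurable_lebesgue_integral[OF this swap]
  have "(\<lambda>s. \<integral>\<omega>. h \<omega> s \<partial>M) \<in> borel_measurable lborel" .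
  also have "(\<lambda>s. \<integral>\<omega>. h \<omega> s \<partial>M) = (\<lambda>s. indicator {0..} s * law M X s $ k)"
  proof
    fix s
    show "(\<integral>\<omega>. h \<omega> s \<partial>M) = indicator {0..} s * law M X s $ k"
    proof (cases "s \<ge> 0")
      case True
      have "{\<omega> \<in> space M. X s \<omega> = k} \<in> sets M"
        using ctmcD(2)[OF assms True] by measurable
      moreover have "(\<integral>\<omega>. h \<omega> s \<partial>M) = (\<integral>\<omega>. indicator {\<omega> \<in> space M. X s \<omega> = k} \<omega> \<partial>M)"
        using True by (intro Bochner_Integration.integral_cong) (auto simp: h_def indicator_def)
      ultimately show ?thesis using True by (simp add: law_def Int_absorb1 subset_eq)
    qed (simp add: h_def)
  qed
  finally show ?thesis .
qed

lemma law_mult_set_integrable: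
  fixes X :: "real \<Rightarrow> 'w \<Rightarrow> 'd::finite"
  assumes "ctmc M X A i" and g: "set_integrable lborel {0..} g"
  shows "set_integrable lborel {0..} (\<lambda>s. law M X s $ k * g s)"
  unfolding set_integrable_def
proof (rule Bochner_Integration.integrable_bound[OF g[unfolded set_integrable_def]])
  have "(\<lambda>s. (indicator {0..} s * law M X s $ k) * (indicator {0..} s *\<^sub>R g s)) \<in> borel_measurable lborel"
    using law_measurable[OF assms(1)] borel_measurable_integrable[OF g[unfolded set_integrable_def]]
    by (rule borel_measurable_times)
  also have "(\<lambda>s. (indicator {0..} s * law M X s $ k) * (indicator {0..} s *\<^sub>R g s))
      = (\<lambda>s. indicator {0..} s *\<^sub>R (law M X s $ k * g s))"
    by (auto simp: indicator_def)
  finally show "(\<lambda>s. indicator {0..} s *\<^sub>R (law M X s $ k * g s)) \<in> borel_measurable lborel" .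
  show "AE s in lborel. norm (indicator {0..} s *\<^sub>R (law M X s $ k * g s)) \<le> norm (indicator {0..} s *\<^sub>R g s)"
    using ctmcD(1)[OF assms(1)]
    by (intro AE_I2) (auto simp: abs_mult law_nonneg law_le_1 indicator_def intro!: mult_left_le_one_le)
qed

section \<open>Integrated rewards\<close>

lemma prob_algebra_integrable:
  fixes g :: "'a::metric_space \<Rightarrow> real"
  assumes "\<mu> \<in> space (prob_algebra (restrict_space borel U))" "compact U" "continuous_on U g"
  shows "integrable \<mu> g"
proof -
  have sets: "sets \<mu> = sets (restrict_space borel U)" and "prob_space \<mu>"
    using assms(1) by (auto simp: space_prob_algebra)
  interpret prob_space \<mu> by fact
  have "space \<mu> = U" using sets_eq_imp_space_eq[OF sets] by (simp add: space_restrict_space)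
  obtain B where "\<And>u. u \<in> U \<Longrightarrow> norm (g u) \<le> B"
    using compact_imp_bounded[OF compact_continuous_image[OF assms(3,2)]]
    unfolding bounded_iff by auto
  moreover have "g \<in> borel_measurable \<mu>"
    using borel_measurable_continuous_on_restrict[OF assms(3)] measurable_cong_sets[OF sets refl] by blast
  ultimately show ?thesis
    using \<open>space \<mu> = U\<close> by (intro integrable_const_bound[of _ B]) auto
qed

lemma prob_algebra_integral_le:
  fixes g :: "'a::metric_space \<Rightarrow> real"
  assumes "\<mu> \<in> space (prob_algebra (restrict_space borel U))" "compact U" "continuous_on U g"
    and "\<And>u. u \<in> U \<Longrightarrow> g u \<le> c"
  shows "(\<integral>u. g u \<partial>\<mu>) \<le> c"
proof -
  have sets: "sets \<mu> = sets (restrict_space borel U)" and "prob_space \<mu>"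
    using assms(1) by (auto simp: space_prob_algebra)
  have "space \<mu> = U" using sets_eq_imp_space_eq[OF sets] by (simp add: space_restrict_space)
  then show ?thesis
    using assms(4) by (intro prob_space.integral_le_const[OF \<open>prob_space \<mu>\<close>] prob_algebra_integrable[OF assms(1-3)]) auto
qed

lemma prob_algebra_abs_integral_le:
  fixes g :: "'a::metric_space \<Rightarrow> real"
  assumes "\<mu> \<in> space (prob_algebra (restrict_space borel U))" "compact U" "continuous_on U g"
    and "\<And>u. u \<in> U \<Longrightarrow> \<bar>g u\<bar> \<le> c"
  shows "\<bar>\<integral>u. g u \<partial>\<mu>\<bar> \<le> c"
proof -
  have "\<bar>\<integral>u. g u \<partial>\<mu>\<bar> \<le> (\<integral>u. \<bar>g u\<bar> \<partial>\<mu>)" by (rule integral_abs_bound)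
  also have "\<dots> \<le> c"
    using assms(3,4) by (intro prob_algebra_integral_le[OF assms(1,2)] continuous_intros)
  finally show ?thesis .
qed

text \<open>Replacing the action by the first member of a dense sequence within
  \<open>inverse (real (Suc n))\<close> makes the second argument countably valued, so measurability
  in \<open>x\<close> suffices. Continuity in the action recovers \<open>g\<close> as the pointwise
  limit.\<close>

lemma caratheodory_jointly_measurable:
  fixes g :: "'a \<Rightarrow> 'b::{metric_space, second_countable_topology} \<Rightarrow> real"
  assumes meas: "\<And>u. u \<in> U \<Longrightarrow> (\<lambda>x. g x u) \<in> borel_measurable M"
    and cont: "\<And>x. x \<in> space M \<Longrightarrow> continuous_on U (g x)"
  shows "(\<lambda>(x, u). g x u) \<in> borel_measurable (M \<Otimes>\<^sub>M restrict_space borel U)"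
proof (cases "U = {}")
  case True
  then show ?thesis by (auto simp: measurable_def space_pair_measure space_restrict_space)
next
  case False
  obtain D where D: "countable D" "D \<subseteq> U" "U \<subseteq> closure D" using separable by blast
  have "D \<noteq> {}" using False D(3) by auto
  define d where "d = from_nat_into D"
  have d: "d m \<in> U" for m using from_nat_into[OF \<open>D \<noteq> {}\<close>] D(2) by (auto simp: d_def)
  have approx: "\<exists>m. dist (d m) u < e" if "u \<in> U" "e > 0" for u e
  proof -
    have "u \<in> closure D" using that(1) D(3) by blast
    then obtain y where "y \<in> D" "dist y u < e" using \<open>e > 0\<close> unfolding closure_approachable by blast
    moreover obtain m where "d m = y"
      using from_nat_into_surj[OF D(1) \<open>y \<in> D\<close>] unfolding d_def by blast
    ultimately show ?thesis by blast
  qed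
  define N where "N n u = (LEAST m. dist (d m) u < inverse (real (Suc n)))" for n and u :: 'b
  have N: "dist (d (N n u)) u < inverse (real (Suc n))" if "u \<in> U" for n u
    unfolding N_def by (rule LeastI_ex, rule approx[OF that]) simp
  have [measurable]: "N n \<in> measurable (restrict_space borel U) (count_space UNIV)" for n
    unfolding N_def by (intro measurable_Least measurable_restrict_space1) measurable
  show ?thesis
  proof (rule borel_measurable_LIMSEQ_real[where u = "\<lambda>n (x, u). g x (d (N n u))"])
    fix n
    have [measurable]: "(\<lambda>x. g x (d m)) \<in> borel_measurable M" for m by (rule meas[OF d])
    have "(\<lambda>z. g (fst z) (d (N n (snd z)))) \<in> borel_measurable (M \<Otimes>\<^sub>M restrict_space borel U)"
      by (rule measurable_compose_countable[where g = "\<lambda>z. N n (snd z)"]) measurable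
    then show "(\<lambda>(x, u). g x (d (N n u))) \<in> borel_measurable (M \<Otimes>\<^sub>M restrict_space borel U)"
      by (simp add: split_beta')
  next
    fix z assume "z \<in> space (M \<Otimes>\<^sub>M restrict_space borel U)"
    then obtain x u where z: "z = (x, u)" "x \<in> space M" "u \<in> U"
      by (auto simp: space_pair_measure space_restrict_space)
    have "(\<lambda>n. d (N n u)) \<longlonglongrightarrow> u"
      by (rule tendsto_dist_iff[THEN iffD2], rule Lim_null_comparison[OF always_eventually LIMSEQ_inverse_real_of_nat])
        (use N[OF z(3)] less_imp_le in fastforce)
    then have "(\<lambda>n. g x (d (N n u))) \<longlonglongrightarrow> g x u"
      using d by (intro continuous_on_tendsto_compose[OF cont[OF z(2)]]) (auto simp: z)
    then show "(\<lambda>n. case z of (x, u) \<Rightarrow> g x (d (N n u))) \<longlonglongrightarrow> (case z of (x, u) \<Rightarrow> g x u)"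
      by (simp add: z(1))
  qed
qed

lemma regular_rewardD:
  assumes "regular_reward U f"
  shows "u \<in> U \<Longrightarrow> (\<lambda>t. f t i u) \<in> borel_measurable (restrict_space borel {0..})"
    and "t \<ge> 0 \<Longrightarrow> continuous_on U (f t i)"
    and "uniform_limit U (\<lambda>t. f t i) (f 0 i) (at_right 0)"
  using assms unfolding regular_reward_def by auto

text \<open>The supremum over a countable dense \<open>D\<close> is Borel measurable in time, and
  continuity in the action extends its bound to all of \<open>U\<close>. The resulting
  \<open>F\<close> is the majorant behind the dominated convergence arguments below.\<close>

lemma reward_dominated:
  fixes f :: "real \<Rightarrow> 'd::finite \<Rightarrow> real ^ 'l \<Rightarrow> real"
  assumes "compact U" and f: "regular_reward U f" and "total_bound U f \<delta> < \<infinity>"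
  obtains F where "set_integrable lborel {0..} F" "\<And>s. F s \<ge> 0"
    "\<And>s i u. s \<ge> 0 \<Longrightarrow> u \<in> U \<Longrightarrow> \<bar>f s i u\<bar> \<le> F s"
proof -
  obtain D where D: "countable D" "D \<subseteq> U" "U \<subseteq> closure D" using separable by blast
  have clD: "closure D = U"
    using D closure_minimal[OF D(2) compact_imp_closed[OF \<open>compact U\<close>]] by blast
  define E where "E s = (SUP i. SUP u\<in>D. ennreal \<bar>f s i u\<bar>)" for s
  define F where "F s = enn2real (E s)" for s
  have [measurable]: "(\<lambda>s. f s i u) \<in> borel_measurable (restrict_space borel {0..})" if "u \<in> D" for i u
    using regular_rewardD(1)[OF f] D(2) that by blast
  have E_meas: "E \<in> borel_measurable (restrict_space borel {0..})"
    unfolding E_def by (intro borel_measurable_SUP D(1)) auto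
  \<comment> \<open>Compactness of \<open>U\<close> enters here: \<open>enn2real\<close> would turn
    an infinite supremum into \<open>0\<close> and destroy the bound.\<close>
  have E_finite: "E s < \<infinity>" if "s \<ge> 0" for s
  proof -
    have "\<exists>B. \<forall>u\<in>U. \<bar>f s i u\<bar> \<le> B" for i
      using compact_imp_bounded[OF compact_continuous_image[OF regular_rewardD(2)[OF f that] \<open>compact U\<close>]]
      unfolding bounded_iff by auto
    then obtain B where B: "\<And>i u. u \<in> U \<Longrightarrow> \<bar>f s i u\<bar> \<le> B i" by metis
    have "E s \<le> ennreal (Max (range B))"
      unfolding E_def
    proof (intro SUP_least ennreal_leI)
      fix i u assume "u \<in> D"
      then have "\<bar>f s i u\<bar> \<le> B i" using D(2) B by blast
      also have "\<dots> \<le> Max (range B)" by simp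
      finally show "\<bar>f s i u\<bar> \<le> Max (range B)" .
    qed
    then show ?thesis using le_less_trans by fastforce
  qed
  have dom: "\<bar>f s i u\<bar> \<le> F s" if "s \<ge> 0" "u \<in> U" for s i u
  proof (rule continuous_le_on_closure[of D "\<lambda>u. \<bar>f s i u\<bar>" u "F s"])
    show "continuous_on (closure D) (\<lambda>u. \<bar>f s i u\<bar>)"
      unfolding clD using regular_rewardD(2)[OF f that(1)] by (intro continuous_intros)
    show "u \<in> closure D" using that clD by simp
    fix v assume "v \<in> D"
    then have "ennreal \<bar>f s i v\<bar> \<le> E s" unfolding E_def by (intro SUP_upper2[of i]) (auto intro: SUP_upper)
    then show "\<bar>f s i v\<bar> \<le> F s"
      using E_finite[OF that(1)] unfolding F_def by (metis enn2real_ennreal enn2real_mono abs_ge_zero infinity_ennreal_def)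
  qed
  have "integrable lborel (\<lambda>s. indicator {0..} s *\<^sub>R F s)"
  proof (rule integrableI_bounded)
    have "F \<in> borel_measurable (restrict_space borel {0..})"
      unfolding F_def[abs_def] using E_meas by measurable
    then show "(\<lambda>s. indicator {0..} s *\<^sub>R F s) \<in> borel_measurable lborel"
      by (simp add: borel_measurable_restrict_space_iff)
    have "(\<integral>\<^sup>+ s. ennreal (norm (indicator {0..} s *\<^sub>R F s)) \<partial>lborel)
        \<le> (\<integral>\<^sup>+ s. ((SUP i. SUP u\<in>U. ennreal \<bar>f s i u\<bar>) + ennreal (\<delta> s)) * indicator {0..} s \<partial>lborel)"
    proof (rule nn_integral_mono)
      fix s :: real
      have "ennreal (F s) \<le> (SUP i. SUP u\<in>U. ennreal \<bar>f s i u\<bar>) + ennreal (\<delta> s)" if "s \<ge> 0"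
      proof -
        have "ennreal (F s) = E s" using E_finite[OF that] by (simp add: F_def)
        also have "\<dots> \<le> (SUP i. SUP u\<in>U. ennreal \<bar>f s i u\<bar>)"
          unfolding E_def by (intro SUP_mono' SUP_subset_mono D(2)) auto
        finally show ?thesis by (simp add: add_increasing2)
      qed
      then show "ennreal (norm (indicator {0..} s *\<^sub>R F s))
          \<le> ((SUP i. SUP u\<in>U. ennreal \<bar>f s i u\<bar>) + ennreal (\<delta> s)) * indicator {0..} s"
        by (simp add: indicator_def F_def)
    qed
    \<comment> \<open>\<open>total_bound\<close> integrates over the completion of
      \<open>lborel\<close>, which gives the same nonnegative integral.\<close>
    also have "\<dots> = total_bound U f \<delta>"
      unfolding total_bound_def by (rule nn_integral_completion[symmetric])
    finally show "(\<integral>\<^sup>+ s. ennreal (norm (indicator {0..} s *\<^sub>R F s)) \<partial>lborel) < \<infinity>"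
      using \<open>total_bound U f \<delta> < \<infinity>\<close> by (rule le_less_trans)
  qed
  then show ?thesis
    using that[of F] dom by (simp add: set_integrable_def F_def)
qed

section \<open>Relaxed rewards as functions of time\<close>

lemma relaxed_reward_measurable:
  assumes \<mu>: "\<mu> \<in> space (prob_algebra (restrict_space borel U))" and f: "regular_reward U f"
  shows "(\<lambda>s. relaxed_reward f \<mu> s i) \<in> borel_measurable (restrict_space borel {0..})"
proof -
  have sets: "sets \<mu> = sets (restrict_space borel U)" and "prob_space \<mu>"
    using \<mu> by (auto simp: space_prob_algebra)
  interpret prob_space \<mu> by fact
  have "(\<lambda>(s, u). f s i u) \<in> borel_measurable (restrict_space borel {0..} \<Otimes>\<^sub>M restrict_space borel U)"
    by (rule caratheodory_jointly_measurable) (use regular_rewardD(1,2)[OF f] in \<open>auto simp: space_restrict_space\<close>)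
  then have "(\<lambda>(s, u). f s i u) \<in> borel_measurable (restrict_space borel {0..} \<Otimes>\<^sub>M \<mu>)"
    by (simp cong: measurable_cong_sets add: sets_pair_measure_cong[OF refl sets])
  then show ?thesis
    unfolding relaxed_reward_def by (rule borel_measurable_lebesgue_integral)
qed

lemma relaxed_reward_set_integrable:
  assumes \<mu>: "\<mu> \<in> space (prob_algebra (restrict_space borel U))" and "compact U" and f: "regular_reward U f"
    and F: "set_integrable lborel {0..} F" "\<And>s i u. s \<ge> 0 \<Longrightarrow> u \<in> U \<Longrightarrow> \<bar>f s i u\<bar> \<le> F s"
  shows "set_integrable lborel {0..} (\<lambda>s. relaxed_reward f \<mu> s i)"
  unfolding set_integrable_def
proof (rule Bochner_Integration.integrable_bound[OF F(1)[unfolded set_integrable_def]])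
  show "(\<lambda>s. indicator {0..} s *\<^sub>R relaxed_reward f \<mu> s i) \<in> borel_measurable lborel"
    using relaxed_reward_measurable[OF \<mu> f] by (simp add: borel_measurable_restrict_space_iff)
  have "\<bar>relaxed_reward f \<mu> s i\<bar> \<le> F s" if "s \<ge> 0" for s
    unfolding relaxed_reward_def using F(2)[OF that] regular_rewardD(2)[OF f that]
    by (intro prob_algebra_abs_integral_le[OF \<mu> \<open>compact U\<close>])
  then show "AE s in lborel. norm (indicator {0..} s *\<^sub>R relaxed_reward f \<mu> s i)
      \<le> norm (indicator {0..} s *\<^sub>R F s)"
    by (intro AE_I2) (auto simp: indicator_def intro: order_trans[OF _ abs_ge_self])
qed

text \<open>The rewards converge uniformly in the action, and averaging against a probability
  measure preserves a uniform bound.\<close>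

lemma relaxed_reward_tendsto_0:
  assumes \<mu>: "\<mu> \<in> space (prob_algebra (restrict_space borel U))" and "compact U" and f: "regular_reward U f"
  shows "((\<lambda>s. relaxed_reward f \<mu> s i) \<longlongrightarrow> relaxed_reward f \<mu> 0 i) (at_right 0)"
proof (rule tendstoI)
  fix e :: real assume "e > 0"
  then have "\<forall>\<^sub>F s in at_right 0. \<forall>u\<in>U. dist (f s i u) (f 0 i u) < e / 2"
    using regular_rewardD(3)[OF f] by (intro uniform_limitD) auto
  moreover have "\<forall>\<^sub>F s in at_right (0::real). s > 0" by (rule eventually_at_right_less)
  ultimately show "\<forall>\<^sub>F s in at_right 0. dist (relaxed_reward f \<mu> s i) (relaxed_reward f \<mu> 0 i) < e"
  proof eventually_elim
    case (elim s)
    have c: "continuous_on U (f s i)" "continuous_on U (f 0 i)"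
      using regular_rewardD(2)[OF f] elim by auto
    have "relaxed_reward f \<mu> s i - relaxed_reward f \<mu> 0 i = (\<integral>u. f s i u - f 0 i u \<partial>\<mu>)"
      unfolding relaxed_reward_def
      by (intro Bochner_Integration.integral_diff[symmetric] prob_algebra_integrable[OF \<mu> \<open>compact U\<close>] c)
    moreover have "\<bar>\<integral>u. f s i u - f 0 i u \<partial>\<mu>\<bar> \<le> e / 2"
      using elim c by (intro prob_algebra_abs_integral_le[OF \<mu> \<open>compact U\<close>] continuous_intros)
        (auto simp: dist_real_def less_imp_le)
    ultimately show ?case using \<open>e > 0\<close> by (simp add: dist_real_def)
  qed
qed

text \<open>The integrand may change together with the window. What controls the averages is the
  modulus \<open>\<rho>\<close>, which is common to all \<open>n\<close>.\<close>

lemma average_tendsto: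
  fixes \<epsilon> :: "nat \<Rightarrow> real" and h :: "nat \<Rightarrow> real \<Rightarrow> real"
  assumes \<epsilon>: "\<And>n. \<epsilon> n > 0" "\<epsilon> \<longlonglongrightarrow> 0"
    and int: "\<And>n. set_integrable lborel {0<..<\<epsilon> n} (h n)"
    and bound: "\<And>n s. 0 < s \<Longrightarrow> s < \<epsilon> n \<Longrightarrow> \<bar>h n s - c\<bar> \<le> \<rho> s"
    and \<rho>: "(\<rho> \<longlongrightarrow> 0) (at_right 0)"
  shows "(\<lambda>n. (LINT s:{0<..<\<epsilon> n}|lborel. h n s) / \<epsilon> n) \<longlonglongrightarrow> c"
proof (rule tendstoI)
  fix e :: real assume "e > 0"
  then have "\<forall>\<^sub>F s in at_right 0. dist (\<rho> s) 0 < e / 2"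
    by (intro tendstoD[OF \<rho>]) simp
  then obtain b where b: "b > 0" "\<And>s. 0 < s \<Longrightarrow> s < b \<Longrightarrow> \<bar>\<rho> s\<bar> < e / 2"
    unfolding eventually_at_right_field by auto
  have "\<forall>\<^sub>F n in sequentially. \<epsilon> n < b" using order_tendstoD(2)[OF \<epsilon>(2) b(1)] .
  then show "\<forall>\<^sub>F n in sequentially. dist ((LINT s:{0<..<\<epsilon> n}|lborel. h n s) / \<epsilon> n) c < e"
  proof eventually_elim
    case (elim n)
    have const: "set_integrable lborel {0<..<\<epsilon> n} (\<lambda>s. k :: real)" for k
      using \<epsilon>(1)[of n] by (simp add: set_integrable_def integrable_real_indicator)
    have "(LINT s:{0<..<\<epsilon> n}|lborel. h n s) - c * \<epsilon> n = (LINT s:{0<..<\<epsilon> n}|lborel. h n s - c)"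
      using \<epsilon>(1)[of n] by (subst set_integral_diff(2)[OF int const]) (simp add: set_lebesgue_integral_def mult.commute)
    also have "\<bar>\<dots>\<bar> \<le> (LINT s:{0<..<\<epsilon> n}|lborel. e / 2)"
    proof -
      have "\<bar>LINT s:{0<..<\<epsilon> n}|lborel. h n s - c\<bar> \<le> (LINT s:{0<..<\<epsilon> n}|lborel. \<bar>h n s - c\<bar>)"
        using set_integral_norm_bound[OF set_integral_diff(1)[OF int const]] by simp
      also have "\<dots> \<le> (LINT s:{0<..<\<epsilon> n}|lborel. e / 2)"
      proof (rule set_integral_mono)
        show "set_integrable lborel {0<..<\<epsilon> n} (\<lambda>s. \<bar>h n s - c\<bar>)"
          by (intro set_integrable_abs set_integral_diff(1)[OF int const])
        fix s assume "s \<in> {0<..<\<epsilon> n}"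
        then show "\<bar>h n s - c\<bar> \<le> e / 2" using bound[of s n] b(2)[of s] elim by auto
      qed (rule const)
      finally show ?thesis .
    qed
    also have "\<dots> = e / 2 * \<epsilon> n" using \<epsilon>(1)[of n] by (simp add: set_lebesgue_integral_def mult.commute)
    finally have "\<bar>(LINT s:{0<..<\<epsilon> n}|lborel. h n s) / \<epsilon> n - c\<bar> \<le> e / 2"
      using \<epsilon>(1)[of n] by (simp add: abs_le_iff field_simps)
    then show ?case using \<open>e > 0\<close> by (simp add: dist_real_def)
  qed
qed

text \<open>The term at \<open>t = 0\<close> of the supremum bounds the difference quotients of
  every row of \<open>q\<close>, since the reward quotient added to them is nonnegative.\<close>

lemma lipschitz_bound_imp_continuous:
  fixes q :: "real ^ 'l \<Rightarrow> real ^ 'd ^ 'd::finite"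
  assumes "lipschitz_bound U f q < \<infinity>"
  shows "continuous_on U q"
proof -
  define L where "L = enn2real (lipschitz_bound U f q)"
  have L: "lipschitz_bound U f q = ennreal L" "L \<ge> 0"
    using assms by (simp_all add: L_def)
  have lip: "norm (q u $ i - q v $ i) \<le> L * norm (u - v)" if "u \<in> U" "v \<in> U" for u v i
  proof (cases "u = v")
    case False
    have "ennreal (\<bar>f (real 0) i u - f (real 0) i v\<bar> / norm (u - v) + norm (q u $ i - q v $ i) / norm (u - v)) \<le> ennreal L"
      unfolding L(1)[symmetric] lipschitz_bound_def
      using that False by (intro SUP_upper2[of 0] SUP_upper2[of i] SUP_upper2[of u] SUP_upper2[of v]) auto
    then have "\<bar>f (real 0) i u - f (real 0) i v\<bar> / norm (u - v) + norm (q u $ i - q v $ i) / norm (u - v) \<le> L"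
      using L(2) by (simp add: ennreal_le_iff del: ennreal_plus)
    moreover have "0 \<le> \<bar>f (real 0) i u - f (real 0) i v\<bar> / norm (u - v)" by simp
    ultimately have "norm (q u $ i - q v $ i) / norm (u - v) \<le> L" by linarith
    then show ?thesis using False by (simp add: divide_le_eq)
  qed simp
  have "continuous_on U (\<lambda>u. q u $ i)" for i
    by (rule lipschitz_on_continuous_on[OF lipschitz_onI[of _ _ L]]) (use lip L(2) in \<open>auto simp: dist_norm\<close>)
  then show ?thesis using continuous_on_vec_lambda[of U "\<lambda>i u. q u $ i"] by simp
qed

section \<open>First-order effect of a switch\<close>

lemma axis_vector_matrix_mult: "axis i 1 v* (A :: real ^ 'n ^ 'm) = A $ i"
proof -
  have "axis i 1 v* A = (\<Sum>k\<in>UNIV. if k = i then A $ k else 0)"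
    unfolding vector_matrix_mult_sum_rows by (intro sum.cong) (auto simp: axis_def)
  then show ?thesis by simp
qed

lemma set_integral_sum:
  fixes g :: "'a \<Rightarrow> 'b \<Rightarrow> real"
  assumes "\<And>k. k \<in> I \<Longrightarrow> set_integrable M A (g k)"
  shows "set_integrable M A (\<lambda>s. \<Sum>k\<in>I. g k s)"
    and "(LINT s:A|M. (\<Sum>k\<in>I. g k s)) = (\<Sum>k\<in>I. LINT s:A|M. g k s)"
  using assms unfolding set_integrable_def set_lebesgue_integral_def
  by (simp_all add: sum_distrib_left)

text \<open>Time \<open>0\<close> is split off as a null set, so that the first window is open as in
  \<open>average_tendsto\<close>.\<close>

lemma set_integral_split_atLeast:
  fixes h :: "real \<Rightarrow> real"
  assumes h: "set_integrable lborel {0..} h" and "\<epsilon> > 0"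
  shows "(LINT s:{0..}|lborel. h s) = (LINT s:{0<..<\<epsilon>}|lborel. h s) + (LINT s:{\<epsilon>..}|lborel. h s)"
proof -
  have "(LINT s:{0..}|lborel. h s) = (LINT s:{0} \<union> ({0<..<\<epsilon>} \<union> {\<epsilon>..})|lborel. h s)"
    using \<open>\<epsilon> > 0\<close> by (intro arg_cong[where f = "\<lambda>A. LINT s:A|lborel. h s"]) auto
  also have "\<dots> = (LINT s:{0}|lborel. h s) + (LINT s:{0<..<\<epsilon>} \<union> {\<epsilon>..}|lborel. h s)"
    by (intro set_integral_Un set_integrable_subset[OF h]) (use \<open>\<epsilon> > 0\<close> in auto)
  also have "(LINT s:{0}|lborel. h s) = 0"
    unfolding set_lebesgue_integral_def
    by (rule integral_eq_zero_AE) (use AE_lborel_singleton[of 0] in eventually_elim, auto)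
  also have "(LINT s:{0<..<\<epsilon>} \<union> {\<epsilon>..}|lborel. h s) = (LINT s:{0<..<\<epsilon>}|lborel. h s) + (LINT s:{\<epsilon>..}|lborel. h s)"
    by (intro set_integral_Un set_integrable_subset[OF h]) (use \<open>\<epsilon> > 0\<close> in auto)
  finally show ?thesis by simp
qed

text \<open>Here \<open>F\<close> is the integrable majorant supplied by
  \<open>reward_dominated\<close>, and \<open>continuous_q\<close> is supplied by
  \<open>lipschitz_bound_imp_continuous\<close>.\<close>

locale controlled_chain_problem =
  fixes U :: "(real ^ 'l::finite) set"
    and q :: "real ^ 'l \<Rightarrow> real ^ 'd ^ 'd::finite"
    and f :: "real \<Rightarrow> 'd \<Rightarrow> real ^ 'l \<Rightarrow> real"
    and P :: "('d, 'l) control \<Rightarrow> 'd \<Rightarrow> 'w measure"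
    and X :: "('d, 'l) control \<Rightarrow> real \<Rightarrow> 'w \<Rightarrow> 'd"
    and F :: "real \<Rightarrow> real"
  assumes compact_U: "compact U" and U_nonempty: "U \<noteq> {}"
    and continuous_q: "continuous_on U q"
    and regular_f: "regular_reward U f"
    and chains: "controlled_chains U q P X"
    and F_integrable: "set_integrable lborel {0..} F"
    and F_nonneg: "\<And>s. F s \<ge> 0"
    and F_bound: "\<And>s i u. s \<ge> 0 \<Longrightarrow> u \<in> U \<Longrightarrow> \<bar>f s i u\<bar> \<le> F s"
begin

definition feedback_generator :: "('d, 'l) feedback \<Rightarrow> real ^ 'd ^ 'd" where
  "feedback_generator \<pi> = (\<chi> i j. \<integral>u. q u $ i $ j \<partial>(\<pi> i))"

abbreviation stationary_law :: "('d, 'l) feedback \<Rightarrow> 'd \<Rightarrow> real \<Rightarrow> real ^ 'd" where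
  "stationary_law \<pi> i \<equiv> law (P (stationary \<pi>) i) (X (stationary \<pi>))"

lemma feedback_prob: "\<pi> \<in> relaxed_feedbacks U \<Longrightarrow> \<pi> i \<in> space (prob_algebra (restrict_space borel U))"
  by (simp add: relaxed_feedbacks_def)

lemma control_generator_stationary: "control_generator q (stationary \<pi>) = (\<lambda>_. feedback_generator \<pi>)"
  by (simp add: fun_eq_iff control_generator_def stationary_def feedback_generator_def)

lemma control_generator_switch:
  "control_generator q (switch \<epsilon> \<pi>' \<pi>) t = (if t < \<epsilon> then feedback_generator \<pi>' else feedback_generator \<pi>)"
  by (simp add: control_generator_def switch_def feedback_generator_def)

lemma ctmc_stationary:
  assumes "\<pi> \<in> relaxed_feedbacks U"
  shows "ctmc (P (stationary \<pi>) i) (X (stationary \<pi>)) (\<lambda>_. feedback_generator \<pi>) i"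
proof -
  have "stationary \<pi> \<in> admissible_controls U" using assms unfolding admissible_controls_def by blast
  then show ?thesis using chains unfolding controlled_chains_def control_generator_stationary[symmetric] by blast
qed

lemma ctmc_switch:
  assumes "\<epsilon> > 0" "\<pi>' \<in> relaxed_feedbacks U" "\<pi> \<in> relaxed_feedbacks U"
  shows "ctmc (P (switch \<epsilon> \<pi>' \<pi>) i) (X (switch \<epsilon> \<pi>' \<pi>)) (control_generator q (switch \<epsilon> \<pi>' \<pi>)) i"
proof -
  have "switch \<epsilon> \<pi>' \<pi> \<in> admissible_controls U" using assms unfolding admissible_controls_def by blast
  then show ?thesis using chains unfolding controlled_chains_def by blast
qed

lemma stationary_law_has_derivative:
  assumes "\<pi> \<in> relaxed_feedbacks U" "t \<ge> 0"
  shows "(stationary_law \<pi> i has_vector_derivative stationary_law \<pi> i t v* feedback_generator \<pi>) (at t within {0..})"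
  using ctmc_law_has_integral[OF ctmc_stationary[OF assms(1)]] ctmc_law_0[OF ctmc_stationary[OF assms(1)]]
  by (intro integral_equation_has_derivative_atLeast assms(2)) metis

lemma stationary_law_bound:
  assumes "\<pi> \<in> relaxed_feedbacks U"
  shows "\<bar>stationary_law \<pi> i t $ k\<bar> \<le> 1"
  using law_nonneg[of "P (stationary \<pi>) i" "X (stationary \<pi>)" t k]
    law_le_1[OF ctmcD(1)[OF ctmc_stationary[OF assms, of i]], of "X (stationary \<pi>)" t k] by simp

lemma reward_set_integrable:
  assumes "\<pi> \<in> relaxed_feedbacks U"
  shows "set_integrable lborel {0..} (\<lambda>s. relaxed_reward f (\<pi> k) s i)"
  by (rule relaxed_reward_set_integrable[OF feedback_prob[OF assms] compact_U regular_f F_integrable F_bound])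

lemma reward_bound:
  assumes "\<pi> \<in> relaxed_feedbacks U" "s \<ge> 0"
  shows "\<bar>relaxed_reward f (\<pi> k) s i\<bar> \<le> F s"
  unfolding relaxed_reward_def using F_bound[OF assms(2)] regular_rewardD(2)[OF regular_f assms(2)]
  by (intro prob_algebra_abs_integral_le[OF feedback_prob[OF assms(1)] compact_U])

lemma payoff_stationary:
  assumes "\<pi> \<in> relaxed_feedbacks U"
  shows "payoff P X f (stationary \<pi>) i
    = (LINT s:{0..}|lborel. (\<Sum>k\<in>UNIV. stationary_law \<pi> i s $ k * relaxed_reward f (\<pi> k) s k))"
  using expected_reward_eq[OF ctmc_stationary[OF assms], of "\<lambda>k s. relaxed_reward f (\<pi> k) s k"]
    reward_set_integrable[OF assms]
  unfolding payoff_def stationary_def by simp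

definition switch_reward :: "real \<Rightarrow> ('d, 'l) feedback \<Rightarrow> ('d, 'l) feedback \<Rightarrow> 'd \<Rightarrow> real \<Rightarrow> real" where
  "switch_reward \<epsilon> \<pi>' \<pi> k s = relaxed_reward f (switch \<epsilon> \<pi>' \<pi> s k) s k"

lemma switch_reward_set_integrable:
  assumes "\<pi>' \<in> relaxed_feedbacks U" "\<pi> \<in> relaxed_feedbacks U"
  shows "set_integrable lborel {0..} (switch_reward \<epsilon> \<pi>' \<pi> k)"
proof -
  have "integrable lborel (\<lambda>s. indicator {..<\<epsilon>} s *\<^sub>R (indicator {0..} s *\<^sub>R relaxed_reward f (\<pi>' k) s k)
      + indicator {\<epsilon>..} s *\<^sub>R (indicator {0..} s *\<^sub>R relaxed_reward f (\<pi> k) s k))"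
    using reward_set_integrable[OF assms(1), of k k] reward_set_integrable[OF assms(2), of k k]
    unfolding set_integrable_def
    by (intro Bochner_Integration.integrable_add integrable_mult_indicator[of "{..<\<epsilon>}"]
        integrable_mult_indicator[of "{\<epsilon>..}"]) auto
  also have "(\<lambda>s. indicator {..<\<epsilon>} s *\<^sub>R (indicator {0..} s *\<^sub>R relaxed_reward f (\<pi>' k) s k)
      + indicator {\<epsilon>..} s *\<^sub>R (indicator {0..} s *\<^sub>R relaxed_reward f (\<pi> k) s k))
    = (\<lambda>s. indicator {0..} s *\<^sub>R switch_reward \<epsilon> \<pi>' \<pi> k s)"
    by (auto simp: switch_reward_def switch_def indicator_def)
  finally show ?thesis by (simp add: set_integrable_def)
qed

lemma payoff_switch:
  assumes "\<epsilon> > 0" "\<pi>' \<in> relaxed_feedbacks U" "\<pi> \<in> relaxed_feedbacks U"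
  shows "payoff P X f (switch \<epsilon> \<pi>' \<pi>) i = (LINT s:{0..}|lborel.
    (\<Sum>k\<in>UNIV. law (P (switch \<epsilon> \<pi>' \<pi>) i) (X (switch \<epsilon> \<pi>' \<pi>)) s $ k * switch_reward \<epsilon> \<pi>' \<pi> k s))"
  using expected_reward_eq[where g = "switch_reward \<epsilon> \<pi>' \<pi>",
      OF ctmc_switch[OF assms] switch_reward_set_integrable[OF assms(2,3)]]
  unfolding payoff_def switch_reward_def by simp

text \<open>Subtracting the integral equation up to \<open>\<epsilon>\<close> from the one up to
  \<open>t\<close> restarts it at \<open>\<epsilon>\<close>, and from there on the generator is
  constant.\<close>

lemma switch_law_has_derivative:
  fixes i
  assumes "\<epsilon> > 0" "\<pi>' \<in> relaxed_feedbacks U" "\<pi> \<in> relaxed_feedbacks U" "t \<ge> \<epsilon>"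
  defines "y \<equiv> law (P (switch \<epsilon> \<pi>' \<pi>) i) (X (switch \<epsilon> \<pi>' \<pi>))"
  shows "(y has_vector_derivative y t v* feedback_generator \<pi>) (at t within {\<epsilon>..})"
proof (rule integral_equation_has_derivative_atLeast[OF _ \<open>t \<ge> \<epsilon>\<close>])
  fix t assume t: "t \<ge> \<epsilon>"
  let ?h = "\<lambda>r. y r v* control_generator q (switch \<epsilon> \<pi>' \<pi>) r"
  have int: "(?h has_integral (y s - axis i 1)) {0..s}" if "s \<ge> 0" for s
    unfolding y_def using ctmc_law_has_integral[OF ctmc_switch[OF assms(1-3)] that] .
  have "?h integrable_on {\<epsilon>..t}"
    using integrable_on_subinterval[of ?h "{0..t}" \<epsilon> t] int[of t] t \<open>\<epsilon> > 0\<close> by (auto simp: integrable_on_def)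
  then obtain I where I: "(?h has_integral I) {\<epsilon>..t}" by blast
  have "(?h has_integral (y \<epsilon> - axis i 1 + I)) {0..t}"
    by (rule has_integral_combine[OF _ t int I]) (use \<open>\<epsilon> > 0\<close> in auto)
  then have "y \<epsilon> - axis i 1 + I = y t - axis i 1"
    using int[of t] t \<open>\<epsilon> > 0\<close> by (intro has_integral_unique) auto
  then have "I = y t - y \<epsilon>" by (simp add: algebra_simps)
  with I have "(?h has_integral (y t - y \<epsilon>)) {\<epsilon>..t}" by simp
  then show "((\<lambda>r. y r v* feedback_generator \<pi>) has_integral (y t - y \<epsilon>)) {\<epsilon>..t}"
    by (rule has_integral_eq[rotated]) (simp add: control_generator_switch)
qed

text \<open>At time \<open>\<epsilon>\<close> itself the control has already switched; a single
  point does not affect the integral, so the equation for \<open>\<pi>'\<close> holds up to and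
  including \<open>\<epsilon>\<close>.\<close>

lemma switch_law_has_integral:
  fixes i
  assumes "\<epsilon> > 0" "\<pi>' \<in> relaxed_feedbacks U" "\<pi> \<in> relaxed_feedbacks U" "t \<in> {0..\<epsilon>}"
  defines "y \<equiv> law (P (switch \<epsilon> \<pi>' \<pi>) i) (X (switch \<epsilon> \<pi>' \<pi>))"
  shows "((\<lambda>r. y r v* feedback_generator \<pi>') has_integral (y t - axis i 1)) {0..t}"
proof (rule has_integral_spike_finite[where S = "{\<epsilon>}"])
  show "((\<lambda>r. y r v* control_generator q (switch \<epsilon> \<pi>' \<pi>) r) has_integral (y t - axis i 1)) {0..t}"
    unfolding y_def using ctmc_law_has_integral[OF ctmc_switch[OF assms(1-3)]] assms(4) by auto
qed (use assms(4) in \<open>auto simp: control_generator_switch\<close>)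


text \<open>To first order, a switch gains the difference of the rewards at time \<open>0\<close>
  and displaces the law at time \<open>\<epsilon>\<close> by \<open>\<epsilon>\<close> times the
  difference of the \<open>i\<close>-th generator rows. In the limit the displaced mass collects the
  payoffs of \<open>\<pi>\<close>.\<close>

lemma payoff_switch_derivative:
  assumes \<pi>': "\<pi>' \<in> relaxed_feedbacks U" and \<pi>: "\<pi> \<in> relaxed_feedbacks U"
  shows "((\<lambda>\<epsilon>. (payoff P X f (switch \<epsilon> \<pi>' \<pi>) i - payoff P X f (stationary \<pi>) i) / \<epsilon>) \<longlongrightarrow>
      relaxed_reward f (\<pi>' i) 0 i - relaxed_reward f (\<pi> i) 0 i
      + (\<Sum>j\<in>UNIV. (feedback_generator \<pi>' $ i $ j - feedback_generator \<pi> $ i $ j)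
          * payoff P X f (stationary \<pi>) j)) (at_right 0)"
\<comment> \<open>Passing to sequences makes dominated convergence applicable to the part after the
  switch.\<close>
proof (rule tendsto_at_right_sequentially[of 0 1])
  fix \<epsilon> :: "nat \<Rightarrow> real"
  assume \<epsilon>_pos: "\<And>n. 0 < \<epsilon> n" and \<epsilon>_lim: "\<epsilon> \<longlonglongrightarrow> 0"
  have \<epsilon>_nonneg: "0 \<le> \<epsilon> n" for n using \<epsilon>_pos[of n] by simp
  define Q where "Q = feedback_generator \<pi>"
  define Q' where "Q' = feedback_generator \<pi>'"
  define x where "x = stationary_law \<pi>"
  define y where "y n = law (P (switch (\<epsilon> n) \<pi>' \<pi>) i) (X (switch (\<epsilon> n) \<pi>' \<pi>))" for n
  define g where "g k s = relaxed_reward f (\<pi> k) s k" for k s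
  define g' where "g' k s = relaxed_reward f (\<pi>' k) s k" for k s
  define e :: "real ^ 'd" where "e = axis i 1"
  define z where "z n = y n (\<epsilon> n) - x i (\<epsilon> n)" for n
  define h where "h n s = (\<Sum>k\<in>UNIV. y n s $ k * switch_reward (\<epsilon> n) \<pi>' \<pi> k s) - (\<Sum>k\<in>UNIV. x i s $ k * g k s)" for n s
  note ctmc_y = ctmc_switch[OF \<epsilon>_pos \<pi>' \<pi>]
  note ctmc_x = ctmc_stationary[OF \<pi>]
  obtain C0 where "C0 > 0" and C0: "\<And>(x :: real ^ 'd) (A :: real ^ 'd ^ 'd). norm (x v* A) \<le> norm x * norm A * C0"
    using vector_matrix_mult_bound by blast
  \<comment> \<open>One operator bound that serves both generators.\<close>
  define C where "C = C0 * (norm Q + norm Q')"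
  have "C \<ge> 0" using \<open>C0 > 0\<close> by (simp add: C_def)
  have C: "norm (v v* Q) \<le> C * norm v" "norm (v v* Q') \<le> C * norm v" for v
  proof -
    have "norm v * norm Q * C0 \<le> C * norm v" "norm v * norm Q' * C0 \<le> C * norm v"
      using \<open>C0 > 0\<close> by (simp_all add: C_def algebra_simps)
    then show "norm (v v* Q) \<le> C * norm v" "norm (v v* Q') \<le> C * norm v"
      using C0 order_trans by blast+
  qed
  have y_bdd: "norm (y n s) \<le> 1" if "s \<ge> 0" for n s
    unfolding y_def using norm_law_le_1[OF ctmc_y that] .
  have x_bdd: "norm (x j s) \<le> 1" if "s \<ge> 0" for j s
    unfolding x_def using norm_law_le_1[OF ctmc_x that] .
  have y_int: "((\<lambda>r. y n r v* Q') has_integral (y n t - e)) {0..t}" if "t \<in> {0..\<epsilon> n}" for n t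
    unfolding y_def Q'_def e_def using that by (intro switch_law_has_integral \<epsilon>_pos \<pi> \<pi>')
  have x_int: "((\<lambda>r. x i r v* Q) has_integral (x i t - e)) {0..t}" if "t \<in> {0..\<epsilon> n}" for n t
    unfolding x_def Q_def e_def using that by (intro ctmc_law_has_integral[OF ctmc_x]) auto
  have y_near: "norm (y n s - e) \<le> C * s" if "s \<in> {0..\<epsilon> n}" for n s
    by (rule linear_ode_first_order(1)[OF y_int _ \<open>C \<ge> 0\<close> C(2) that]) (use y_bdd in auto)
  have x_near: "norm (x i s - e) \<le> C * s" if "s \<in> {0..\<epsilon> n}" for n s
    by (rule linear_ode_first_order(1)[OF x_int _ \<open>C \<ge> 0\<close> C(1) that]) (use x_bdd in auto)
  have y_first: "norm (y n (\<epsilon> n) - e - \<epsilon> n *\<^sub>R (e v* Q')) \<le> C\<^sup>2 * (\<epsilon> n)\<^sup>2" for n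
    by (rule linear_ode_first_order(2)[OF y_int _ \<open>C \<ge> 0\<close> C(2)]) (use y_bdd \<epsilon>_nonneg in auto)
  have x_first: "norm (x i (\<epsilon> n) - e - \<epsilon> n *\<^sub>R (e v* Q)) \<le> C\<^sup>2 * (\<epsilon> n)\<^sup>2" for n
    by (rule linear_ode_first_order(2)[OF x_int _ \<open>C \<ge> 0\<close> C(1)]) (use x_bdd \<epsilon>_nonneg in auto)
  have g_int: "set_integrable lborel {0..} (g k)" for k
    unfolding g_def by (rule reward_set_integrable[OF \<pi>])
  have xg_int: "set_integrable lborel {0..} (\<lambda>s. \<Sum>k\<in>UNIV. x j s $ k * g k s)" for j
    unfolding x_def by (intro set_integral_sum(1) law_mult_set_integrable[OF ctmc_x] g_int)
  have yg_int: "set_integrable lborel {0..} (\<lambda>s. \<Sum>k\<in>UNIV. y n s $ k * switch_reward (\<epsilon> n) \<pi>' \<pi> k s)" for n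
    unfolding y_def
    by (intro set_integral_sum(1) law_mult_set_integrable[OF ctmc_y] switch_reward_set_integrable[OF \<pi>' \<pi>])
  have h_int: "set_integrable lborel {0..} (h n)" for n
    unfolding h_def by (intro set_integral_diff(1) yg_int xg_int)
  have V: "payoff P X f (stationary \<pi>) j = (LINT s:{0..}|lborel. \<Sum>k\<in>UNIV. x j s $ k * g k s)" for j
    unfolding payoff_stationary[OF \<pi>] x_def g_def ..

  have diff: "payoff P X f (switch (\<epsilon> n) \<pi>' \<pi>) i - payoff P X f (stationary \<pi>) i
      = (LINT s:{0<..<\<epsilon> n}|lborel. h n s) + (LINT s:{\<epsilon> n..}|lborel. h n s)" for n
  proof -
    have "payoff P X f (switch (\<epsilon> n) \<pi>' \<pi>) i - payoff P X f (stationary \<pi>) i = (LINT s:{0..}|lborel. h n s)"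
      unfolding h_def V payoff_switch[OF \<epsilon>_pos \<pi>' \<pi>] y_def[symmetric]
      by (rule set_integral_diff(2)[OF yg_int xg_int, symmetric])
    then show ?thesis using set_integral_split_atLeast[OF h_int \<epsilon>_pos] by simp
  qed

  \<comment> \<open>Before the switch only the rewards at time 0 matter; afterwards the two laws differ by a
    combination of the laws of the chains restarted at time \<open>\<epsilon> n\<close>, with weights of order \<open>\<epsilon> n\<close>.\<close>
  have "(\<lambda>n. (LINT s:{0<..<\<epsilon> n}|lborel. h n s) / \<epsilon> n) \<longlonglongrightarrow> g' i 0 - g i 0"
  proof (rule average_tendsto[OF \<epsilon>_pos \<epsilon>_lim])
    show "set_integrable lborel {0<..<\<epsilon> n} (h n)" for n
      by (rule set_integrable_subset[OF h_int]) auto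
    \<comment> \<open>The sums account for the laws having moved by at most \<open>C * s\<close>
      away from \<open>e\<close>, the last two terms for the change of the rewards since time
      \<open>0\<close>. Nothing depends on \<open>n\<close>.\<close>
    define \<rho> where "\<rho> s = (\<Sum>k\<in>UNIV. C * s * \<bar>g' k s\<bar>) + (\<Sum>k\<in>UNIV. C * s * \<bar>g k s\<bar>)
        + \<bar>g' i s - g' i 0\<bar> + \<bar>g i s - g i 0\<bar>" for s
    have g_lim: "(g k \<longlongrightarrow> g k 0) (at_right 0)" "(g' k \<longlongrightarrow> g' k 0) (at_right 0)" for k
      unfolding g_def g'_def
      by (rule relaxed_reward_tendsto_0[OF feedback_prob[OF \<pi>] compact_U regular_f],
          rule relaxed_reward_tendsto_0[OF feedback_prob[OF \<pi>'] compact_U regular_f])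
    have "(\<rho> \<longlongrightarrow> (\<Sum>k\<in>UNIV. C * 0 * \<bar>g' k 0\<bar>) + (\<Sum>k\<in>UNIV. C * 0 * \<bar>g k 0\<bar>)
        + \<bar>g' i 0 - g' i 0\<bar> + \<bar>g i 0 - g i 0\<bar>) (at_right 0)"
      unfolding \<rho>_def by (intro tendsto_intros g_lim)
    then show "(\<rho> \<longlongrightarrow> 0) (at_right 0)" by simp
    fix n s assume s: "0 < s" "s < \<epsilon> n"
    have e_sum: "(\<Sum>k\<in>UNIV. e $ k * G k) = G i" for G :: "'d \<Rightarrow> real"
    proof -
      have "(\<Sum>k\<in>UNIV. e $ k * G k) = (\<Sum>k\<in>UNIV. if k = i then G k else 0)"
        by (intro sum.cong) (auto simp: e_def axis_def)
      then show ?thesis by simp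
    qed
    have near: "\<bar>(\<Sum>k\<in>UNIV. v $ k * G k) - G i\<bar> \<le> (\<Sum>k\<in>UNIV. C * s * \<bar>G k\<bar>)"
      if "norm (v - e) \<le> C * s" for v :: "real ^ 'd" and G
    proof -
      have "(\<Sum>k\<in>UNIV. v $ k * G k) - G i = (\<Sum>k\<in>UNIV. (v - e) $ k * G k)"
        by (simp add: left_diff_distrib sum_subtractf e_sum)
      also have "\<bar>\<dots>\<bar> \<le> (\<Sum>k\<in>UNIV. \<bar>(v - e) $ k * G k\<bar>)" by (rule sum_abs)
      also have "\<dots> \<le> (\<Sum>k\<in>UNIV. C * s * \<bar>G k\<bar>)"
        unfolding abs_mult
        by (intro sum_mono mult_right_mono order_trans[OF component_le_norm_cart that]) auto
      finally show ?thesis .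
    qed
    have "h n s = (\<Sum>k\<in>UNIV. y n s $ k * g' k s) - (\<Sum>k\<in>UNIV. x i s $ k * g k s)"
      using s by (simp add: h_def switch_reward_def switch_def g'_def)
    then show "\<bar>h n s - (g' i 0 - g i 0)\<bar> \<le> \<rho> s"
      using near[OF y_near, of n "\<lambda>k. g' k s"] near[OF x_near, of n "\<lambda>k. g k s"] s
      unfolding \<rho>_def by auto
  qed
  moreover have "(\<lambda>n. (LINT s:{\<epsilon> n..}|lborel. h n s) / \<epsilon> n) \<longlonglongrightarrow>
      (\<Sum>j\<in>UNIV. (Q' $ i $ j - Q $ i $ j) * payoff P X f (stationary \<pi>) j)"
  proof -
    have decomp: "y n s - x i s = (\<Sum>j\<in>UNIV. z n $ j *\<^sub>R x j (s - \<epsilon> n))" if "s \<ge> \<epsilon> n" for n s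
      unfolding z_def
    proof (rule linear_ode_decomposition[where y = "\<lambda>s. y n s - x i s" and Q = Q])
      show "x j 0 = axis j 1" for j
        unfolding x_def by (rule ctmc_law_0[OF ctmc_x])
      show "(x j has_vector_derivative x j t v* Q) (at t within {0..})" if "t \<ge> 0" for j t
        unfolding x_def Q_def by (rule stationary_law_has_derivative[OF \<pi> that])
      show "((\<lambda>s. y n s - x i s) has_vector_derivative (y n t - x i t) v* Q) (at t within {\<epsilon> n..})"
        if "t \<ge> \<epsilon> n" for t
      proof -
        have "(y n has_vector_derivative y n t v* Q) (at t within {\<epsilon> n..})"
          unfolding y_def Q_def by (rule switch_law_has_derivative[OF \<epsilon>_pos \<pi>' \<pi> that])
        moreover have "(x i has_vector_derivative x i t v* Q) (at t within {\<epsilon> n..})"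
          unfolding x_def Q_def
          by (rule has_vector_derivative_within_subset[OF stationary_law_has_derivative[OF \<pi>]])
            (use \<epsilon>_pos[of n] that in auto)
        ultimately show ?thesis by (simp add: vector_matrix_mult_diff_distrib has_vector_derivative_diff)
      qed
    qed (rule that)
    \<comment> \<open>The displacement of the law per unit of switching time. The first-order
      expansions of both laws leave the difference of the rows, and each contributes an error of
      \<open>C\<^sup>2 * \<epsilon> n\<close>.\<close>
    define r where "r n = (1 / \<epsilon> n) *\<^sub>R z n" for n
    have r_lim: "r \<longlonglongrightarrow> Q' $ i - Q $ i"
    proof -
      have r_bound: "norm (r n - (Q' $ i - Q $ i)) \<le> 2 * C\<^sup>2 * \<epsilon> n" for n
      proof -
        have "z n - \<epsilon> n *\<^sub>R (Q' $ i - Q $ i)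
            = (y n (\<epsilon> n) - e - \<epsilon> n *\<^sub>R (e v* Q')) - (x i (\<epsilon> n) - e - \<epsilon> n *\<^sub>R (e v* Q))"
          by (simp add: z_def e_def axis_vector_matrix_mult algebra_simps)
        also have "norm \<dots> \<le> C\<^sup>2 * (\<epsilon> n)\<^sup>2 + C\<^sup>2 * (\<epsilon> n)\<^sup>2"
          by (rule order_trans[OF norm_triangle_ineq4 add_mono[OF y_first x_first]])
        finally have "norm (z n - \<epsilon> n *\<^sub>R (Q' $ i - Q $ i)) \<le> \<epsilon> n * (2 * C\<^sup>2 * \<epsilon> n)"
          by (simp add: power2_eq_square algebra_simps)
        moreover have "z n - \<epsilon> n *\<^sub>R (Q' $ i - Q $ i) = \<epsilon> n *\<^sub>R (r n - (Q' $ i - Q $ i))"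
          using \<epsilon>_pos[of n] by (simp add: r_def algebra_simps)
        ultimately show ?thesis using \<epsilon>_pos[of n] by simp
      qed
      have "(\<lambda>n. 2 * C\<^sup>2 * \<epsilon> n) \<longlonglongrightarrow> 0"
        using tendsto_mult_left[OF \<epsilon>_lim, of "2 * C\<^sup>2"] by simp
      from Lim_null_comparison[OF always_eventually[OF allI[OF r_bound]] this]
      have "(\<lambda>n. r n - (Q' $ i - Q $ i)) \<longlonglongrightarrow> 0" .
      then show ?thesis by (simp add: LIM_zero_iff)
    qed
    then obtain K where K: "K > 0" "\<And>n. norm (r n) \<le> K"
      using convergent_imp_Bseq[of r] unfolding convergent_def Bseq_def by blast
    have h_eq: "h n s / \<epsilon> n = (\<Sum>k\<in>UNIV. (\<Sum>j\<in>UNIV. r n $ j * x j (s - \<epsilon> n) $ k) * g k s)" if "s \<ge> \<epsilon> n" for n s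
    proof -
      have "h n s = (\<Sum>k\<in>UNIV. (y n s - x i s) $ k * g k s)"
        using that by (simp add: h_def switch_reward_def switch_def g_def algebra_simps sum_subtractf)
      also have "\<dots> = (\<Sum>k\<in>UNIV. (\<Sum>j\<in>UNIV. z n $ j * x j (s - \<epsilon> n) $ k) * g k s)"
        unfolding decomp[OF that] by (simp add: sum_component)
      finally show ?thesis by (simp add: r_def sum_divide_distrib sum_distrib_right)
    qed
    \<comment> \<open>The expected pointwise limit: \<open>r n\<close> is replaced by its limit and
      the time shift by \<open>\<epsilon> n\<close> disappears.\<close>
    define w where "w s = (\<Sum>k\<in>UNIV. (\<Sum>j\<in>UNIV. (Q' $ i $ j - Q $ i $ j) * x j s $ k) * g k s)" for s
    have w_eq: "w s = (\<Sum>j\<in>UNIV. (Q' $ i $ j - Q $ i $ j) * (\<Sum>k\<in>UNIV. x j s $ k * g k s))" for s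
      unfolding w_def sum_distrib_left sum_distrib_right by (subst sum.swap) (simp add: mult.assoc)
    have w_int: "set_integrable lborel {0..} w"
      unfolding w_eq by (intro set_integral_sum(1) set_integrable_mult_right xg_int)
    have "(\<lambda>n. \<integral>s. indicator {\<epsilon> n..} s *\<^sub>R (h n s / \<epsilon> n) \<partial>lborel) \<longlonglongrightarrow> (\<integral>s. indicator {0..} s *\<^sub>R w s \<partial>lborel)"
    proof (rule integral_dominated_convergence)
      show "(\<lambda>s. indicator {0..} s *\<^sub>R w s) \<in> borel_measurable lborel"
        using w_int unfolding set_integrable_def by (rule borel_measurable_integrable)
      have "set_integrable lborel {\<epsilon> n..} (h n)" for n
        by (rule set_integrable_subset[OF h_int]) (use \<epsilon>_pos[of n] in auto)
      then have "set_integrable lborel {\<epsilon> n..} (\<lambda>s. h n s / \<epsilon> n)" for n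
        by (rule set_integrable_divide)
      then show "(\<lambda>s. indicator {\<epsilon> n..} s *\<^sub>R (h n s / \<epsilon> n)) \<in> borel_measurable lborel" for n
        unfolding set_integrable_def by (rule borel_measurable_integrable)
      \<comment> \<open>Each sum over states contributes a factor \<open>CARD('d)\<close>; entries
        of \<open>r n\<close> are bounded by \<open>K\<close>, entries of the laws by
        \<open>1\<close>, and rewards by \<open>F\<close>.\<close>
      show "integrable lborel (\<lambda>s. (real CARD('d) * (real CARD('d) * K)) * (indicator {0..} s *\<^sub>R F s))"
        using F_integrable unfolding set_integrable_def by (rule integrable_mult_right)
      \<comment> \<open>The point \<open>s = 0\<close> must be excluded: there every indicator on
        the left is zero, while the one in the limit is one.\<close>
      show "AE s in lborel. (\<lambda>n. indicator {\<epsilon> n..} s *\<^sub>R (h n s / \<epsilon> n)) \<longlonglongrightarrow> indicator {0..} s *\<^sub>R w s"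
        using AE_lborel_singleton[of 0]
      proof eventually_elim
        case (elim s)
        show ?case
        proof (cases "s > 0")
          case True
          have "\<forall>\<^sub>F n in sequentially. \<epsilon> n < s" using order_tendstoD(2)[OF \<epsilon>_lim True] .
          then have ev: "\<forall>\<^sub>F n in sequentially. indicator {\<epsilon> n..} s *\<^sub>R (h n s / \<epsilon> n)
              = (\<Sum>k\<in>UNIV. (\<Sum>j\<in>UNIV. r n $ j * x j (s - \<epsilon> n) $ k) * g k s)"
            by eventually_elim (simp add: h_eq)
          have x_lim: "(\<lambda>n. x j (s - \<epsilon> n)) \<longlonglongrightarrow> x j s" for j
          proof -
            have "continuous_on {0..} (x j)"
              unfolding continuous_on_eq_continuous_within x_def
              using stationary_law_has_derivative[OF \<pi>] has_vector_derivative_continuous by (metis atLeast_iff)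
            moreover have "(\<lambda>n. s - \<epsilon> n) \<longlonglongrightarrow> s" using tendsto_diff[OF tendsto_const \<epsilon>_lim, of s] by simp
            moreover have "\<forall>\<^sub>F n in sequentially. s - \<epsilon> n \<in> {0..}"
              using \<open>\<forall>\<^sub>F n in sequentially. \<epsilon> n < s\<close> by eventually_elim simp
            ultimately show ?thesis using True by (intro continuous_on_tendsto_compose[of "{0..}" "x j"]) auto
          qed
          have "(\<lambda>n. \<Sum>k\<in>UNIV. (\<Sum>j\<in>UNIV. r n $ j * x j (s - \<epsilon> n) $ k) * g k s)
              \<longlonglongrightarrow> (\<Sum>k\<in>UNIV. (\<Sum>j\<in>UNIV. (Q' $ i - Q $ i) $ j * x j s $ k) * g k s)"
            by (intro tendsto_intros r_lim x_lim)
          then have "(\<lambda>n. \<Sum>k\<in>UNIV. (\<Sum>j\<in>UNIV. r n $ j * x j (s - \<epsilon> n) $ k) * g k s) \<longlonglongrightarrow> indicator {0..} s *\<^sub>R w s"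
            using True by (simp add: w_def)
          then show ?thesis using tendsto_cong[OF ev] by simp
        next
          case False
          then have "indicator {\<epsilon> n..} s = (0 :: real)" for n using \<epsilon>_pos[of n] by (simp add: indicator_def)
          moreover have "indicator {0..} s = (0 :: real)" using False elim by (simp add: indicator_def)
          ultimately show ?thesis by simp
        qed
      qed
      show "AE s in lborel. norm (indicator {\<epsilon> n..} s *\<^sub>R (h n s / \<epsilon> n))
          \<le> (real CARD('d) * (real CARD('d) * K)) * (indicator {0..} s *\<^sub>R F s)" for n
      proof (rule AE_I2)
        fix s :: real
        show "norm (indicator {\<epsilon> n..} s *\<^sub>R (h n s / \<epsilon> n))
          \<le> (real CARD('d) * (real CARD('d) * K)) * (indicator {0..} s *\<^sub>R F s)"
        proof (cases "s \<ge> \<epsilon> n")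
          case True
          then have "s \<ge> 0" using \<epsilon>_pos[of n] by simp
          have inner: "\<bar>\<Sum>j\<in>UNIV. r n $ j * x j (s - \<epsilon> n) $ k\<bar> \<le> real CARD('d) * K" for k
          proof -
            have "\<bar>r n $ j * x j (s - \<epsilon> n) $ k\<bar> \<le> K * 1" for j
              unfolding abs_mult x_def
              by (intro mult_mono order_trans[OF component_le_norm_cart K(2)] stationary_law_bound[OF \<pi>])
                (use K(1) in auto)
            then have "(\<Sum>j\<in>UNIV. \<bar>r n $ j * x j (s - \<epsilon> n) $ k\<bar>) \<le> (\<Sum>j::'d\<in>UNIV. K * 1)"
              by (intro sum_mono)
            then show ?thesis by (intro order_trans[OF sum_abs]) simp
          qed
          have "\<bar>h n s / \<epsilon> n\<bar> \<le> (\<Sum>k\<in>UNIV. \<bar>(\<Sum>j\<in>UNIV. r n $ j * x j (s - \<epsilon> n) $ k) * g k s\<bar>)"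
            unfolding h_eq[OF True] by (rule sum_abs)
          also have "\<dots> \<le> (\<Sum>k::'d\<in>UNIV. real CARD('d) * K * F s)"
            unfolding abs_mult g_def
            by (intro sum_mono mult_mono inner reward_bound[OF \<pi> \<open>s \<ge> 0\<close>]) (use K(1) in auto)
          finally show ?thesis using True \<open>s \<ge> 0\<close> by (simp add: indicator_def mult.assoc)
        qed (use F_nonneg[of s] K(1) in simp)
      qed
    qed
    also have "(\<lambda>n. \<integral>s. indicator {\<epsilon> n..} s *\<^sub>R (h n s / \<epsilon> n) \<partial>lborel) = (\<lambda>n. (LINT s:{\<epsilon> n..}|lborel. h n s) / \<epsilon> n)"
      by (simp add: set_lebesgue_integral_def)
    also have "(\<integral>s. indicator {0..} s *\<^sub>R w s \<partial>lborel)
        = (\<Sum>j\<in>UNIV. (Q' $ i $ j - Q $ i $ j) * payoff P X f (stationary \<pi>) j)"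
    proof -
      have "(LINT s:{0..}|lborel. w s) = (\<Sum>j\<in>UNIV. LINT s:{0..}|lborel. (Q' $ i $ j - Q $ i $ j) * (\<Sum>k\<in>UNIV. x j s $ k * g k s))"
        unfolding w_eq by (intro set_integral_sum(2) set_integrable_mult_right xg_int)
      then show ?thesis by (simp add: V set_lebesgue_integral_def[of _ _ w])
    qed
    finally show ?thesis .
  qed
  ultimately have "(\<lambda>n. (LINT s:{0<..<\<epsilon> n}|lborel. h n s) / \<epsilon> n + (LINT s:{\<epsilon> n..}|lborel. h n s) / \<epsilon> n)
      \<longlonglongrightarrow> g' i 0 - g i 0 + (\<Sum>j\<in>UNIV. (Q' $ i $ j - Q $ i $ j) * payoff P X f (stationary \<pi>) j)"
    by (rule tendsto_add)
  then show "(\<lambda>n. (payoff P X f (switch (\<epsilon> n) \<pi>' \<pi>) i - payoff P X f (stationary \<pi>) i) / \<epsilon> n) \<longlonglongrightarrow>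
      relaxed_reward f (\<pi>' i) 0 i - relaxed_reward f (\<pi> i) 0 i
      + (\<Sum>j\<in>UNIV. (feedback_generator \<pi>' $ i $ j - feedback_generator \<pi> $ i $ j)
          * payoff P X f (stationary \<pi>) j)"
    by (simp add: diff add_divide_distrib g_def g'_def Q_def Q'_def)
qed simp

section \<open>Existence of an equilibrium\<close>

text \<open>Deterministic feedbacks, coded as vectors so that they form a compact subset of a
  Euclidean space.\<close>

definition profiles :: "(real ^ 'l ^ 'd) set" where
  "profiles = {v. \<forall>i. v $ i \<in> U}"

definition profile_generator :: "real ^ 'l ^ 'd \<Rightarrow> real ^ 'd ^ 'd" where
  "profile_generator v = (\<chi> i. q (v $ i) $ i)"

text \<open>
  The marginals of a random profile; the arbitrary point of \<open>U\<close> only makes the map total, profiles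
  outside \<open>profiles\<close> never have positive weight below.
\<close>

definition mixture :: "(real ^ 'l ^ 'd) pmf \<Rightarrow> ('d, 'l) feedback" where
  "mixture p = (\<lambda>i. distr (measure_pmf p) (restrict_space borel U)
     (\<lambda>v. if v $ i \<in> U then v $ i else (SOME u. u \<in> U)))"

lemma some_in_U: "(SOME u. u \<in> U) \<in> U"
  using U_nonempty by (simp add: some_in_eq)

lemma mixture_feedback: "mixture p \<in> relaxed_feedbacks U"
proof -
  have "(\<lambda>v. if v $ i \<in> U then v $ i else (SOME u. u \<in> U))
      \<in> measurable (measure_pmf p) (restrict_space borel U)" for i :: 'd
    by (simp add: measurable_def space_restrict_space some_in_U)
  then have "prob_space (mixture p i)" for i
    unfolding mixture_def by (intro prob_space.prob_space_distr prob_space_measure_pmf)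
  then show ?thesis
    by (simp add: relaxed_feedbacks_def space_prob_algebra mixture_def)
qed

lemma mixture_integral:
  fixes g :: "real ^ 'l \<Rightarrow> real"
  assumes g: "continuous_on U g" and p: "finite (set_pmf p)" "set_pmf p \<subseteq> profiles"
  shows "(\<integral>u. g u \<partial>mixture p i) = (\<Sum>v\<in>set_pmf p. pmf p v * g (v $ i))"
proof -
  have "(\<integral>u. g u \<partial>mixture p i) = (\<integral>v. g (if v $ i \<in> U then v $ i else (SOME u. u \<in> U)) \<partial>measure_pmf p)"
    unfolding mixture_def
    by (intro integral_distr borel_measurable_continuous_on_restrict g)
      (simp add: measurable_def space_restrict_space some_in_U)
  also have "\<dots> = (\<Sum>v\<in>set_pmf p. pmf p v *\<^sub>R g (if v $ i \<in> U then v $ i else (SOME u. u \<in> U)))"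
    by (rule integral_measure_pmf[OF p(1)])
  also have "\<dots> = (\<Sum>v\<in>set_pmf p. pmf p v * g (v $ i))"
    using p(2) by (intro sum.cong) (auto simp: profiles_def)
  finally show ?thesis .
qed

lemma continuous_q_nth: "continuous_on U (\<lambda>u. q u $ i $ j)"
  by (intro continuous_intros continuous_q)

text \<open>Row \<open>i\<close> of a profile's generator depends on coordinate \<open>i\<close>
  only, so forgetting the correlations between coordinates, as \<open>mixture\<close> does, leaves
  the average unchanged.\<close>

lemma generator_mixture:
  assumes "finite (set_pmf p)" "set_pmf p \<subseteq> profiles"
  shows "feedback_generator (mixture p) = (\<Sum>v\<in>set_pmf p. pmf p v *\<^sub>R profile_generator v)"
  by (simp add: vec_eq_iff feedback_generator_def mixture_integral[OF continuous_q_nth assms]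
      profile_generator_def sum_component)

text \<open>The compact convex set in which the generator is sought; each of its members is the
  generator of some mixture.\<close>

definition generators :: "(real ^ 'd ^ 'd) set" where
  "generators = convex hull (profile_generator ` profiles)"

text \<open>
  The law of the chain depends on the feedback only through its generator, so any choice will do.
\<close>

definition representative :: "real ^ 'd ^ 'd \<Rightarrow> ('d, 'l) feedback" where
  "representative Q = (SOME \<pi>. \<pi> \<in> relaxed_feedbacks U \<and> feedback_generator \<pi> = Q)"

lemma representative:
  assumes "Q \<in> generators"
  shows "representative Q \<in> relaxed_feedbacks U" "feedback_generator (representative Q) = Q"
proof -
  obtain p where "finite (set_pmf p)" "set_pmf p \<subseteq> profiles"
    "Q = (\<Sum>v\<in>set_pmf p. pmf p v *\<^sub>R profile_generator v)"
    by (rule convex_hull_image_pmf[OF assms[unfolded generators_def]])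
  then have "feedback_generator (mixture p) = Q" by (simp add: generator_mixture)
  then have "\<exists>\<pi>. \<pi> \<in> relaxed_feedbacks U \<and> feedback_generator \<pi> = Q"
    using mixture_feedback by blast
  from someI_ex[OF this] show "representative Q \<in> relaxed_feedbacks U" "feedback_generator (representative Q) = Q"
    by (simp_all add: representative_def)
qed

section \<open>Laws and payoffs as functions of the generator\<close>

abbreviation generator_law :: "real ^ 'd ^ 'd \<Rightarrow> 'd \<Rightarrow> real \<Rightarrow> real ^ 'd" where
  "generator_law Q \<equiv> stationary_law (representative Q)"

lemma stationary_law_continuous_dependence:
  assumes "\<And>n. \<pi>s n \<in> relaxed_feedbacks U" "\<pi> \<in> relaxed_feedbacks U"
    and "(\<lambda>n. feedback_generator (\<pi>s n)) \<longlonglongrightarrow> feedback_generator \<pi>" and "t \<ge> 0"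
  shows "(\<lambda>n. stationary_law (\<pi>s n) i t) \<longlonglongrightarrow> stationary_law \<pi> i t"
proof (rule linear_ode_continuous_dependence[OF \<open>t \<ge> 0\<close> _ _ _ _ assms(3)])
  show "stationary_law (\<pi>s n) i 0 = stationary_law \<pi> i 0" for n
    using ctmc_law_0[OF ctmc_stationary[OF assms(1)]] ctmc_law_0[OF ctmc_stationary[OF assms(2)]] by simp
  show "norm (stationary_law \<pi> i s) \<le> 1" if "s \<in> {0..t}" for s
    using norm_law_le_1[OF ctmc_stationary[OF assms(2)]] that by auto
  show "(stationary_law (\<pi>s n) i has_vector_derivative stationary_law (\<pi>s n) i s v* feedback_generator (\<pi>s n))
      (at s within {0..t})" if "s \<in> {0..t}" for n s
    by (rule has_vector_derivative_within_subset[OF stationary_law_has_derivative[OF assms(1)]]) (use that in auto)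
  show "(stationary_law \<pi> i has_vector_derivative stationary_law \<pi> i s v* feedback_generator \<pi>)
      (at s within {0..t})" if "s \<in> {0..t}" for s
    by (rule has_vector_derivative_within_subset[OF stationary_law_has_derivative[OF assms(2)]]) (use that in auto)
qed

text \<open>Uniqueness is continuous dependence applied to a constant sequence. It makes the choice
  of \<open>representative\<close> immaterial.\<close>

lemma stationary_law_eqI:
  assumes "\<pi> \<in> relaxed_feedbacks U" "\<pi>' \<in> relaxed_feedbacks U" "feedback_generator \<pi> = feedback_generator \<pi>'" "t \<ge> 0"
  shows "stationary_law \<pi> i t = stationary_law \<pi>' i t"
  using stationary_law_continuous_dependence[of "\<lambda>_. \<pi>" \<pi>' t i] assms by (simp add: LIMSEQ_const_iff)

text \<open>The function G of the overview, with \<open>generator_law Q i s $ k\<close> in place of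
  the entry of the matrix exponential.\<close>

definition occupation_reward :: "real ^ 'd ^ 'd \<Rightarrow> 'd \<Rightarrow> 'd \<Rightarrow> real ^ 'l \<Rightarrow> real" where
  "occupation_reward Q i k u = (LINT s:{0..}|lborel. generator_law Q i s $ k * f s k u)"

lemma action_reward_set_integrable:
  assumes "u \<in> U"
  shows "set_integrable lborel {0..} (\<lambda>s. f s k u)"
  unfolding set_integrable_def
proof (rule Bochner_Integration.integrable_bound[OF F_integrable[unfolded set_integrable_def]])
  show "(\<lambda>s. indicator {0..} s *\<^sub>R f s k u) \<in> borel_measurable lborel"
    using regular_rewardD(1)[OF regular_f assms] by (simp add: borel_measurable_restrict_space_iff)
  show "AE s in lborel. norm (indicator {0..} s *\<^sub>R f s k u) \<le> norm (indicator {0..} s *\<^sub>R F s)"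
    using F_bound[OF _ assms] F_nonneg by (intro AE_I2) (auto simp: indicator_def)
qed

lemma occupation_set_integrable:
  assumes "Q \<in> generators" "u \<in> U"
  shows "set_integrable lborel {0..} (\<lambda>s. generator_law Q i s $ k * f s k u)"
  by (rule law_mult_set_integrable[OF ctmc_stationary[OF representative(1)[OF assms(1)]]
        action_reward_set_integrable[OF assms(2)]])

text \<open>Joint continuity in generator and action, by dominated convergence with majorant
  \<open>F\<close>. Pointwise in time it combines continuity of the laws in the generator with
  continuity of the reward in the action.\<close>

lemma occupation_reward_tendsto:
  assumes "\<And>n. Q n \<in> generators" "R \<in> generators" "Q \<longlonglongrightarrow> R"
    and "\<And>n. u n \<in> U" "v \<in> U" "u \<longlonglongrightarrow> v"
  shows "(\<lambda>n. occupation_reward (Q n) i k (u n)) \<longlonglongrightarrow> occupation_reward R i k v"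
  unfolding occupation_reward_def set_lebesgue_integral_def
proof (rule integral_dominated_convergence)
  show "(\<lambda>s. indicator {0..} s *\<^sub>R (generator_law R i s $ k * f s k v)) \<in> borel_measurable lborel"
    "(\<lambda>s. indicator {0..} s *\<^sub>R (generator_law (Q n) i s $ k * f s k (u n))) \<in> borel_measurable lborel" for n
    using occupation_set_integrable[OF assms(2,5)] occupation_set_integrable[OF assms(1,4)]
    unfolding set_integrable_def by (auto intro: borel_measurable_integrable)
  show "integrable lborel (\<lambda>s. indicator {0..} s *\<^sub>R F s)"
    using F_integrable by (simp add: set_integrable_def)
  show "AE s in lborel. (\<lambda>n. indicator {0..} s *\<^sub>R (generator_law (Q n) i s $ k * f s k (u n)))
      \<longlonglongrightarrow> indicator {0..} s *\<^sub>R (generator_law R i s $ k * f s k v)"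
  proof (rule AE_I2)
    fix s :: real
    show "(\<lambda>n. indicator {0..} s *\<^sub>R (generator_law (Q n) i s $ k * f s k (u n)))
      \<longlonglongrightarrow> indicator {0..} s *\<^sub>R (generator_law R i s $ k * f s k v)"
    proof (cases "s \<ge> 0")
      case True
      have "(\<lambda>n. generator_law (Q n) i s) \<longlonglongrightarrow> generator_law R i s"
        by (rule stationary_law_continuous_dependence) (use assms(1-3) True representative in auto)
      moreover have "(\<lambda>n. f s k (u n)) \<longlonglongrightarrow> f s k v"
        by (rule continuous_on_tendsto_compose[OF regular_rewardD(2)[OF regular_f True] assms(6,5)])
          (simp add: assms(4))
      ultimately show ?thesis by (intro tendsto_intros)
    qed simp
  qed
  show "AE s in lborel. norm (indicator {0..} s *\<^sub>R (generator_law (Q n) i s $ k * f s k (u n)))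
      \<le> indicator {0..} s *\<^sub>R F s" for n
  proof (rule AE_I2)
    fix s :: real
    have "\<bar>generator_law (Q n) i s $ k * f s k (u n)\<bar> \<le> 1 * F s" if "s \<ge> 0"
      unfolding abs_mult
      by (intro mult_mono stationary_law_bound representative assms F_bound that) auto
    then show "norm (indicator {0..} s *\<^sub>R (generator_law (Q n) i s $ k * f s k (u n))) \<le> indicator {0..} s *\<^sub>R F s"
      by (simp add: indicator_def)
  qed
qed

lemma occupation_reward_bound:
  assumes "Q \<in> generators" "u \<in> U"
  shows "\<bar>occupation_reward Q i k u\<bar> \<le> (LINT s:{0..}|lborel. F s)"
proof -
  have "\<bar>occupation_reward Q i k u\<bar> \<le> (LINT s:{0..}|lborel. \<bar>generator_law Q i s $ k * f s k u\<bar>)"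
    unfolding occupation_reward_def using set_integral_norm_bound[OF occupation_set_integrable[OF assms]] by simp
  also have "\<dots> \<le> (LINT s:{0..}|lborel. F s)"
  proof (rule set_integral_mono[OF set_integrable_abs[OF occupation_set_integrable[OF assms]] F_integrable])
    fix s :: real assume "s \<in> {0..}"
    then have "\<bar>generator_law Q i s $ k * f s k u\<bar> \<le> 1 * F s"
      unfolding abs_mult
      by (intro mult_mono stationary_law_bound representative assms F_bound) auto
    then show "\<bar>generator_law Q i s $ k * f s k u\<bar> \<le> F s" by simp
  qed
  finally show ?thesis .
qed

text \<open>The law of the chain may be replaced by that of the representative with the same
  generator. With the law thus fixed, the payoff is linear in the mixing weights.\<close>

lemma payoff_mixture:
  assumes p: "finite (set_pmf p)" "set_pmf p \<subseteq> profiles" and Q: "feedback_generator (mixture p) = Q" "Q \<in> generators"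
  shows "payoff P X f (stationary (mixture p)) i
    = (\<Sum>v\<in>set_pmf p. pmf p v * (\<Sum>k\<in>UNIV. occupation_reward Q i k (v $ k)))"
proof -
  have U: "v $ k \<in> U" if "v \<in> set_pmf p" for v k using that p(2) by (auto simp: profiles_def)
  have "payoff P X f (stationary (mixture p)) i
    = (LINT s:{0..}|lborel. (\<Sum>k\<in>UNIV. stationary_law (mixture p) i s $ k * relaxed_reward f (mixture p k) s k))"
    by (rule payoff_stationary[OF mixture_feedback])
  also have "\<dots> = (LINT s:{0..}|lborel. (\<Sum>v\<in>set_pmf p. \<Sum>k\<in>UNIV. pmf p v * (generator_law Q i s $ k * f s k (v $ k))))"
  proof (rule set_lebesgue_integral_cong)
    show "\<forall>s. s \<in> {0..} \<longrightarrow> (\<Sum>k\<in>UNIV. stationary_law (mixture p) i s $ k * relaxed_reward f (mixture p k) s k)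
        = (\<Sum>v\<in>set_pmf p. \<Sum>k\<in>UNIV. pmf p v * (generator_law Q i s $ k * f s k (v $ k)))"
    proof (intro allI impI)
      fix s :: real assume "s \<in> {0..}"
      then have "s \<ge> 0" by simp
      have "stationary_law (mixture p) i s = generator_law Q i s"
        by (rule stationary_law_eqI) (use mixture_feedback representative[OF Q(2)] Q(1) \<open>s \<ge> 0\<close> in auto)
      moreover have "relaxed_reward f (mixture p k) s k = (\<Sum>v\<in>set_pmf p. pmf p v * f s k (v $ k))" for k
        unfolding relaxed_reward_def by (rule mixture_integral[OF regular_rewardD(2)[OF regular_f \<open>s \<ge> 0\<close>] p])
      ultimately have "(\<Sum>k\<in>UNIV. stationary_law (mixture p) i s $ k * relaxed_reward f (mixture p k) s k)
        = (\<Sum>k\<in>UNIV. \<Sum>v\<in>set_pmf p. pmf p v * (generator_law Q i s $ k * f s k (v $ k)))"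
        by (simp add: sum_distrib_left mult.left_commute)
      then show "(\<Sum>k\<in>UNIV. stationary_law (mixture p) i s $ k * relaxed_reward f (mixture p k) s k)
        = (\<Sum>v\<in>set_pmf p. \<Sum>k\<in>UNIV. pmf p v * (generator_law Q i s $ k * f s k (v $ k)))"
        by (subst sum.swap)
    qed
  qed simp
  also have "\<dots> = (\<Sum>v\<in>set_pmf p. \<Sum>k\<in>UNIV. LINT s:{0..}|lborel. pmf p v * (generator_law Q i s $ k * f s k (v $ k)))"
    using occupation_set_integrable[OF Q(2) U]
    by (subst set_integral_sum(2); (intro set_integral_sum(1) sum.cong refl set_integral_sum(2) set_integrable_mult_right)?) auto
  also have "\<dots> = (\<Sum>v\<in>set_pmf p. pmf p v * (\<Sum>k\<in>UNIV. occupation_reward Q i k (v $ k)))"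
    by (simp add: occupation_reward_def sum_distrib_left)
  finally show ?thesis .
qed

section \<open>Maximising profiles and the consistency fixed point\<close>

lemma compact_profiles: "compact profiles"
proof -
  obtain B where B: "\<And>u. u \<in> U \<Longrightarrow> norm u \<le> B"
    using compact_imp_bounded[OF compact_U] unfolding bounded_iff by auto
  have "norm v \<le> real CARD('d) * B" if "v \<in> profiles" for v
  proof -
    have "norm v \<le> (\<Sum>i\<in>UNIV. norm (v $ i))" by (simp add: norm_vec_def L2_set_le_sum)
    also have "\<dots> \<le> (\<Sum>i::'d\<in>UNIV. B)" using that by (intro sum_mono B) (simp add: profiles_def)
    finally show ?thesis by simp
  qed
  then have "bounded profiles" unfolding bounded_iff by blast
  moreover have "closed profiles"
    unfolding closed_sequential_limits
  proof (intro allI impI)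
    fix x l assume x: "(\<forall>n. x n \<in> profiles) \<and> x \<longlonglongrightarrow> l"
    then have "l $ i \<in> U" for i
      using closed_sequentially[OF compact_imp_closed[OF compact_U], of "\<lambda>n. x n $ i" "l $ i"] tendsto_vec_nth[of x l sequentially i]
      by (auto simp: profiles_def)
    then show "l \<in> profiles" by (simp add: profiles_def)
  qed
  ultimately show ?thesis by (simp add: compact_eq_bounded_closed)
qed

definition hamiltonian :: "real ^ 'd \<Rightarrow> 'd \<Rightarrow> real ^ 'l \<Rightarrow> real" where
  "hamiltonian V i u = f 0 i u + (\<Sum>j\<in>UNIV. q u $ i $ j * V $ j)"

definition optimal_profiles :: "real ^ 'd \<Rightarrow> (real ^ 'l ^ 'd) set" where
  "optimal_profiles V = {v \<in> profiles. \<forall>i. \<forall>u\<in>U. hamiltonian V i u \<le> hamiltonian V i (v $ i)}"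

lemma continuous_hamiltonian: "continuous_on U (hamiltonian V i)"
  unfolding hamiltonian_def
  by (intro continuous_intros continuous_q_nth regular_rewardD(2)[OF regular_f]) simp

lemma hamiltonian_tendsto:
  assumes "V \<longlonglongrightarrow> W" "\<And>n. u n \<in> U" "v \<in> U" "u \<longlonglongrightarrow> v"
  shows "(\<lambda>n. hamiltonian (V n) i (u n)) \<longlonglongrightarrow> hamiltonian W i v"
  unfolding hamiltonian_def
proof (intro tendsto_add tendsto_sum tendsto_mult tendsto_vec_nth assms(1))
  show "(\<lambda>n. f 0 i (u n)) \<longlonglongrightarrow> f 0 i v"
    by (rule continuous_on_tendsto_compose[OF regular_rewardD(2)[OF regular_f] assms(4,3)]) (simp_all add: assms(2))
  show "(\<lambda>n. q (u n)) \<longlonglongrightarrow> q v"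
    by (rule continuous_on_tendsto_compose[OF continuous_q assms(4,3)]) (simp add: assms(2))
qed

lemma optimal_profiles_nonempty: "optimal_profiles V \<noteq> {}"
proof -
  have "\<exists>v\<in>U. \<forall>u\<in>U. hamiltonian V i u \<le> hamiltonian V i v" for i
    using continuous_attains_sup[OF compact_U U_nonempty continuous_hamiltonian] by blast
  then obtain v where "\<And>i. v i \<in> U \<and> (\<forall>u\<in>U. hamiltonian V i u \<le> hamiltonian V i (v i))" by metis
  then have "(\<chi> i. v i) \<in> optimal_profiles V" by (simp add: optimal_profiles_def profiles_def)
  then show ?thesis by blast
qed

lemma profile_generator_tendsto:
  assumes "\<And>n. v n \<in> profiles" "w \<in> profiles" "v \<longlonglongrightarrow> w"
  shows "(\<lambda>n. profile_generator (v n)) \<longlonglongrightarrow> profile_generator w"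
  unfolding profile_generator_def
proof (intro tendsto_vec_lambda tendsto_vec_nth)
  fix i
  show "(\<lambda>n. q (v n $ i)) \<longlonglongrightarrow> q (w $ i)"
    by (rule continuous_on_tendsto_compose[OF continuous_q])
      (use assms in \<open>auto simp: profiles_def intro: tendsto_vec_nth\<close>)
qed

lemma continuous_profile_generator: "continuous_on profiles profile_generator"
  unfolding continuous_on_sequentially using profile_generator_tendsto by (auto simp: o_def)

text \<open>The self-consistency of the equilibrium: the profiles in the support maximise the
  Hamiltonians formed with the payoff of the very mixture they make up. It is a fixed point in pairs
  of a generator and a value vector.\<close>

lemma exists_consistent_mixture:
  obtains p where "finite (set_pmf p)" "set_pmf p \<subseteq> profiles"
    "set_pmf p \<subseteq> optimal_profiles (\<chi> j. payoff P X f (stationary (mixture p)) j)"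
proof -
  \<comment> \<open>Each coordinate of the value component of \<open>\<Psi>\<close> is a sum of
    \<open>CARD('d)\<close> occupation rewards, each at most the integral of \<open>F\<close>; the
    box therefore makes \<open>S\<close> invariant.\<close>
  define B where "B = real CARD('d) * (LINT s:{0..}|lborel. F s)"
  define S where "S = generators \<times> cbox (\<chi> i :: 'd. - B) (\<chi> i. B)"
  define \<Psi> where "\<Psi> = (\<lambda>(Q, V :: real ^ 'd) v. (profile_generator v, \<chi> i. \<Sum>k\<in>UNIV. occupation_reward Q i k (v $ k)))"
  have value_in: "(\<chi> i. \<Sum>k\<in>UNIV. occupation_reward Q i k (v $ k)) \<in> cbox (\<chi> i :: 'd. - B) (\<chi> i. B)"
    if "Q \<in> generators" "v \<in> profiles" for Q v
  proof -
    have "\<bar>\<Sum>k\<in>UNIV. occupation_reward Q i k (v $ k)\<bar> \<le> (\<Sum>k::'d\<in>UNIV. LINT s:{0..}|lborel. F s)" for i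
      using that by (intro order_trans[OF sum_abs] sum_mono occupation_reward_bound) (auto simp: profiles_def)
    then have "\<bar>\<Sum>k\<in>UNIV. occupation_reward Q i k (v $ k)\<bar> \<le> B" for i
      by (simp add: B_def)
    then have "- B \<le> (\<Sum>k\<in>UNIV. occupation_reward Q i k (v $ k)) \<and> (\<Sum>k\<in>UNIV. occupation_reward Q i k (v $ k)) \<le> B" for i
      using abs_le_iff minus_le_iff by blast
    then show ?thesis by (simp add: mem_box_cart)
  qed
  have "profiles \<noteq> {}" using optimal_profiles_nonempty by (auto simp: optimal_profiles_def)
  then obtain v0 where v0: "v0 \<in> profiles" by blast
  have generator_in: "profile_generator v \<in> generators" if "v \<in> profiles" for v
    using that unfolding generators_def by (intro hull_inc imageI)
  have "\<exists>x\<in>S. x \<in> convex hull (\<Psi> x ` optimal_profiles (snd x))"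
  proof (rule convex_hull_fixed_point)
    have "compact generators"
      unfolding generators_def
      by (intro compact_convex_hull compact_continuous_image continuous_profile_generator compact_profiles)
    then show "compact S" unfolding S_def by (intro compact_Times compact_cbox)
    show "convex S" unfolding S_def generators_def by (intro convex_Times convex_convex_hull convex_box)
    show "S \<noteq> {}" unfolding S_def using generator_in[OF v0] value_in[OF generator_in[OF v0] v0] by blast
    show "compact profiles" by (rule compact_profiles)
    show "continuous_on (S \<times> profiles) (\<lambda>(x, a). \<Psi> x a)"
      unfolding continuous_on_sequentially
    proof (intro allI ballI impI, elim conjE)
      fix s l assume l: "l \<in> S \<times> profiles" and s: "\<forall>n. s n \<in> S \<times> profiles" and lim: "s \<longlonglongrightarrow> l"
      obtain Q V v where lQ: "l = ((Q, V), v)" by (cases l) auto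
      have Q_lim: "(\<lambda>n. fst (fst (s n))) \<longlonglongrightarrow> Q" using tendsto_fst[OF tendsto_fst[OF lim]] by (simp add: lQ)
      have v_lim: "(\<lambda>n. snd (s n)) \<longlonglongrightarrow> v" using tendsto_snd[OF lim] by (simp add: lQ)
      have sn: "fst (fst (s n)) \<in> generators" "snd (s n) \<in> profiles" for n
        using s[rule_format, of n] by (auto simp: S_def)
      have Qv: "Q \<in> generators" "v \<in> profiles" using l by (auto simp: lQ S_def)
      have "(\<lambda>n. (profile_generator (snd (s n)), \<chi> i. \<Sum>k\<in>UNIV. occupation_reward (fst (fst (s n))) i k (snd (s n) $ k)))
          \<longlonglongrightarrow> (profile_generator v, \<chi> i. \<Sum>k\<in>UNIV. occupation_reward Q i k (v $ k))"
        by (intro tendsto_Pair profile_generator_tendsto tendsto_vec_lambda tendsto_sum occupation_reward_tendsto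
            sn Qv Q_lim v_lim tendsto_vec_nth)
          (use sn Qv in \<open>auto simp: profiles_def\<close>)
      then show "((\<lambda>(x, a). \<Psi> x a) \<circ> s) \<longlonglongrightarrow> (case l of (x, a) \<Rightarrow> \<Psi> x a)"
        by (simp add: lQ \<Psi>_def o_def split_beta')
    qed
    show "\<Psi> x a \<in> S" if "x \<in> S" "a \<in> profiles" for x a
      using that generator_in value_in by (auto simp: S_def \<Psi>_def)
    show "optimal_profiles (snd x) \<noteq> {}" for x :: "(real ^ 'd ^ 'd) \<times> (real ^ 'd)"
      by (rule optimal_profiles_nonempty)
    show "optimal_profiles (snd x) \<subseteq> profiles" for x :: "(real ^ 'd ^ 'd) \<times> (real ^ 'd)"
      by (auto simp: optimal_profiles_def)
    have "closed S" by (rule compact_imp_closed[OF \<open>compact S\<close>])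
    \<comment> \<open>The inequalities between Hamiltonians that define optimality survive limits
      because the Hamiltonian is jointly continuous in value vector and action.\<close>
    show "closed {(x, a). x \<in> S \<and> a \<in> optimal_profiles (snd x)}"
      unfolding closed_sequential_limits
    proof (intro allI impI, elim conjE)
      fix s l assume s: "\<forall>n. s n \<in> {(x, a). x \<in> S \<and> a \<in> optimal_profiles (snd x)}" and lim: "s \<longlonglongrightarrow> l"
      have x_lim: "(\<lambda>n. fst (s n)) \<longlonglongrightarrow> fst l" and a_lim: "(\<lambda>n. snd (s n)) \<longlonglongrightarrow> snd l"
        using tendsto_fst[OF lim] tendsto_snd[OF lim] .
      have sn: "fst (s n) \<in> S" "snd (s n) \<in> profiles"
        "\<And>i u. u \<in> U \<Longrightarrow> hamiltonian (snd (fst (s n))) i u \<le> hamiltonian (snd (fst (s n))) i (snd (s n) $ i)" for n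
        using s[rule_format, of n] by (auto simp: optimal_profiles_def)
      have lS: "fst l \<in> S" by (rule closed_sequentially[OF \<open>closed S\<close> sn(1) x_lim])
      have lp: "snd l \<in> profiles"
        by (rule closed_sequentially[OF compact_imp_closed[OF compact_profiles] sn(2) a_lim])
      have "hamiltonian (snd (fst l)) i u \<le> hamiltonian (snd (fst l)) i (snd l $ i)" if "u \<in> U" for i u
      proof (rule LIMSEQ_le)
        show "(\<lambda>n. hamiltonian (snd (fst (s n))) i u) \<longlonglongrightarrow> hamiltonian (snd (fst l)) i u"
          by (rule hamiltonian_tendsto) (use that x_lim in \<open>auto intro: tendsto_snd\<close>)
        show "(\<lambda>n. hamiltonian (snd (fst (s n))) i (snd (s n) $ i)) \<longlonglongrightarrow> hamiltonian (snd (fst l)) i (snd l $ i)"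
          by (rule hamiltonian_tendsto)
            (use sn(2) lp x_lim a_lim in \<open>auto simp: profiles_def intro: tendsto_snd tendsto_vec_nth\<close>)
      qed (use sn(3)[OF that] in blast)
      then show "l \<in> {(x, a). x \<in> S \<and> a \<in> optimal_profiles (snd x)}"
        using lS lp by (auto simp: optimal_profiles_def split_beta')
    qed
  qed
  then obtain Q V where QV: "(Q, V) \<in> S" "(Q, V) \<in> convex hull (\<Psi> (Q, V) ` optimal_profiles V)" by auto
  obtain p where p: "finite (set_pmf p)" "set_pmf p \<subseteq> optimal_profiles V"
    and eq: "(Q, V) = (\<Sum>v\<in>set_pmf p. pmf p v *\<^sub>R \<Psi> (Q, V) v)"
    by (rule convex_hull_image_pmf[OF QV(2)])
  have p': "set_pmf p \<subseteq> profiles" using p(2) by (auto simp: optimal_profiles_def)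
  \<comment> \<open>The same weights represent both components. The first identifies
    \<open>Q\<close> as the generator of the mixture, and only then can
    \<open>payoff_mixture\<close> read the second as its payoff.\<close>
  have Q: "feedback_generator (mixture p) = Q"
    using arg_cong[OF eq, of fst] by (simp add: generator_mixture[OF p(1) p'] fst_sum \<Psi>_def)
  have "Q \<in> generators" using QV(1) by (simp add: S_def)
  have "V = (\<Sum>v\<in>set_pmf p. pmf p v *\<^sub>R (\<chi> i. \<Sum>k\<in>UNIV. occupation_reward Q i k (v $ k)))"
    using arg_cong[OF eq, of snd] by (simp add: snd_sum \<Psi>_def)
  then have "V = (\<chi> j. payoff P X f (stationary (mixture p)) j)"
    by (simp add: vec_eq_iff payoff_mixture[OF p(1) p' Q \<open>Q \<in> generators\<close>] sum_component)
  then show ?thesis using that[OF p(1) p'] p(2) by blast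
qed

section \<open>Optimality of the consistent mixture\<close>

lemma hamiltonian_integral:
  assumes "\<pi> \<in> relaxed_feedbacks U"
  shows "(\<integral>u. hamiltonian V i u \<partial>\<pi> i)
    = relaxed_reward f (\<pi> i) 0 i + (\<Sum>j\<in>UNIV. feedback_generator \<pi> $ i $ j * V $ j)"
proof -
  note integrable = prob_algebra_integrable[OF feedback_prob[OF assms] compact_U]
  have "integrable (\<pi> i) (f 0 i)" "integrable (\<pi> i) (\<lambda>u. q u $ i $ j)" for j
    by (intro integrable regular_rewardD(2)[OF regular_f] continuous_q_nth; simp)+
  then show ?thesis
    unfolding hamiltonian_def relaxed_reward_def feedback_generator_def
    by simp
qed

text \<open>By \<open>hamiltonian_integral\<close>, the limit in
  \<open>payoff_switch_derivative\<close> is a difference of averaged Hamiltonians. The average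
  under \<open>\<pi>\<close> runs over maximisers only, so no deviation gains to first
  order.\<close>

theorem exists_relaxed_equilibrium: "\<exists>\<pi>. relaxed_equilibrium U (payoff P X f) \<pi>"
proof -
  obtain p where p: "finite (set_pmf p)" "set_pmf p \<subseteq> profiles"
    and opt: "set_pmf p \<subseteq> optimal_profiles (\<chi> j. payoff P X f (stationary (mixture p)) j)"
    by (rule exists_consistent_mixture)
  define \<pi> where "\<pi> = mixture p"
  define V where "V = (\<chi> j. payoff P X f (stationary \<pi>) j)"
  have \<pi>: "\<pi> \<in> relaxed_feedbacks U" unfolding \<pi>_def by (rule mixture_feedback)
  have "Limsup (at_right 0) (\<lambda>\<epsilon>. ereal ((payoff P X f (switch \<epsilon> \<pi>' \<pi>) i - payoff P X f (stationary \<pi>) i) / \<epsilon>)) \<le> 0"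
    if \<pi>': "\<pi>' \<in> relaxed_feedbacks U" for \<pi>' i
  proof -
    let ?L = "(\<integral>u. hamiltonian V i u \<partial>\<pi>' i) - (\<integral>u. hamiltonian V i u \<partial>\<pi> i)"
    have best: "(\<integral>u. hamiltonian V i u \<partial>\<pi>' i) \<le> hamiltonian V i (v $ i)" if "v \<in> set_pmf p" for v
      using opt that
      by (intro prob_algebra_integral_le[OF feedback_prob[OF \<pi>'] compact_U continuous_hamiltonian])
        (auto simp: optimal_profiles_def V_def \<pi>_def)
    \<comment> \<open>Spreading the constant over the weights of \<open>p\<close>, which sum to one,
      allows a comparison profile by profile.\<close>
    have "(\<integral>u. hamiltonian V i u \<partial>\<pi>' i) = (\<Sum>v\<in>set_pmf p. pmf p v * (\<integral>u. hamiltonian V i u \<partial>\<pi>' i))"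
      using sum_pmf_eq_1[OF p(1) order_refl] by (simp flip: sum_distrib_right)
    also have "\<dots> \<le> (\<Sum>v\<in>set_pmf p. pmf p v * hamiltonian V i (v $ i))"
      by (intro sum_mono mult_left_mono best) auto
    also have "\<dots> = (\<integral>u. hamiltonian V i u \<partial>\<pi> i)"
      unfolding \<pi>_def by (rule mixture_integral[OF continuous_hamiltonian p, symmetric])
    finally have "?L \<le> 0" by simp
    have "((\<lambda>\<epsilon>. (payoff P X f (switch \<epsilon> \<pi>' \<pi>) i - payoff P X f (stationary \<pi>) i) / \<epsilon>) \<longlongrightarrow> ?L) (at_right 0)"
      using payoff_switch_derivative[OF \<pi>' \<pi>, of i]
      by (simp add: hamiltonian_integral[OF \<pi>] hamiltonian_integral[OF \<pi>'] V_def algebra_simps sum_subtractf)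
    then have "((\<lambda>\<epsilon>. ereal ((payoff P X f (switch \<epsilon> \<pi>' \<pi>) i - payoff P X f (stationary \<pi>) i) / \<epsilon>)) \<longlongrightarrow> ereal ?L) (at_right 0)"
      by simp
    then have "Limsup (at_right 0) (\<lambda>\<epsilon>. ereal ((payoff P X f (switch \<epsilon> \<pi>' \<pi>) i - payoff P X f (stationary \<pi>) i) / \<epsilon>)) = ereal ?L"
      by (intro lim_imp_Limsup) simp_all
    then show ?thesis using \<open>?L \<le> 0\<close> by simp
  qed
  then show ?thesis unfolding relaxed_equilibrium_def using \<pi> by blast
qed

end

theorem theorem3p2:
  fixes U :: "(real ^ 'l::{finite,linorder}) set"
    and q :: "real ^ 'l::{finite,linorder} \<Rightarrow> real ^ 'd ^ 'd"
    and f :: "real \<Rightarrow> 'd \<Rightarrow> real ^ 'l::{finite,linorder} \<Rightarrow> real"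
    and \<delta> :: "real \<Rightarrow> real"
    and P :: "('d::finite, 'l::{finite,linorder}) control \<Rightarrow> 'd \<Rightarrow> 'w measure"
    and X :: "('d::finite, 'l::{finite,linorder}) control \<Rightarrow> real \<Rightarrow> 'w \<Rightarrow> 'd"
  assumes "compact U" and "emeasure lebesgue U > 0"
    and "\<And>u. u \<in> U \<Longrightarrow> rate_matrix (q u)"
    and "antimono_on {0..} \<delta>" and "\<delta> 0 = 1" and "\<And>t. t \<ge> 0 \<Longrightarrow> \<delta> t \<in> {0..1}"
    and "regular_reward U f"
    and "controlled_chains U q P X"
    and "total_bound U f \<delta> < \<infinity>"
    and "lipschitz_bound U f q < \<infinity>"
    and "uniform_cone_condition U"
  shows "\<exists>\<pi>. relaxed_equilibrium U (payoff P X f) \<pi>"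
proof -
  obtain F where F: "set_integrable lborel {0..} F" "\<And>s. F s \<ge> 0"
    "\<And>s i u. s \<ge> 0 \<Longrightarrow> u \<in> U \<Longrightarrow> \<bar>f s i u\<bar> \<le> F s"
    using reward_dominated[OF assms(1,7,9)] by blast
  \<comment> \<open>A set of positive measure is nonempty, so the Hamiltonians have
    maximisers.\<close>
  have "U \<noteq> {}" using assms(2) by auto
  interpret controlled_chain_problem U q f P X F
    by unfold_locales (use assms(1,7,8) F \<open>U \<noteq> {}\<close> lipschitz_bound_imp_continuous[OF assms(10)] in auto)
  show ?thesis by (rule exists_relaxed_equilibrium)
qed

end
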